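(* Let $\mathcal{G}$ be a finite connected graph with $V(\mathcal{G})=[n]$, in which every loop is a half-loop, with edge weights $a$ and vertex potential $b$, and let $\mathcal{T}$ be its universal cover with the induced edge weights and vertex potential. Label the half-loops of $\mathcal{G}$ by $f_1,\dots,f_l$ and its non-loop undirected edges by $\{f_{l+1},\check f_{l+1}\},\dots,\{f_m,\check f_m\}$. Let $\Gamma_m=\mathbb{Z}_2\ast\cdots\ast\mathbb{Z}_2$ ($m$ copies) with canonical generators $g_1,\dots,g_m$, and let $\lambda$ be the left regular representation of $\Gamma_m$ on $\ell^2(\Gamma_m)$. Define $X_{\mathcal{G}}\in M_n(\mathbb{C})\otimes C^*_{\mathrm{red}}(\Gamma_m)$ by $$X_{\mathcal{G}}:=\sum_{i=1}^n b_i\,\Delta_{ii}\otimes 1+\sum_{i=1}^l a_{f_i}\,\Delta_{\sigma(f_i)\tau(f_i)}\otimes\lambda(g_i)+\sum_{i=l+1}^m\big(a_{f_i}\Delta_{\sigma(f_i)\tau(f_i)}+a_{\check f_i}\Delta_{\sigma(\check f_i)\tau(\check f_i)}\big)\otimes\lambda(g_i),$$ and let $E:M_n(\mathbb{C})\otimes C^*_{\mathrm{red}}(\Gamma_m)\to M_n(\mathbb{C})$ be the canonical conditional expectation. Then: (i) $E[X_{\mathcal{G}}^p]$ is a diagonal matrix for all $p\in\mathbb{Z}_{\ge0}$. (ii) For any $r\in[n]$, let $\varphi_r:M_n(\mathbb{C})\to\mathbb{C}$, $\varphi_r(B)=B_{rr}$. Then the spectral distribution of $X_{\mathcal{G}}$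 with respect to $\varphi_r\circ E$ is equal to $\mu_r$, the spectral measure of $A_{\mathcal{T}}$ associated to $r$. (iii) The spectral distribution of $X_{\mathcal{G}}$ with respect to $\frac1n\mathrm{Tr}\circ E$ is equal to the density of states of $A_{\mathcal{T}}$.
   Context: Graphs. A graph $\mathcal{G}$ is undirected, with loops and multi-edges allowed, and has a vertex set $V(\mathcal{G})$ and a set $E(\mathcal{G})$ of directed edges; each $f\in E(\mathcal{G})$ has a source $\sigma(f)$, a target $\tau(f)$ and a reversed edge $\check f$ (edge reversal is an involution with $\sigma(\check f)=\tau(f)$, $\tau(\check f)=\sigma(f)$). A half-loop is a single directed edge $f$ with $\sigma(f)=\tau(f)$ and $\check f=f$. (An ordinary loop, i.e. a pair $f\ne\check f$ of directed edges at one vertex, is replaced by two half-loops, so that all loops are half-loops.) Put $\sigma(u)=\{f:\sigma(f)=u\}$. Edge weights: $a:E(\mathcal{G})\to\mathbb{R}$ with $a_f=a_{\check f}$; vertex potential: $b:V(\mathcal{G})\to\mathbb{R}$. The Jacobi matrix of a graph with such data acts on $\ell^2$ of its vertex set by $(A\xi)(u)=b_u\xi(u)+\sum_{f\in\sigma(u)}a_f\,\xi(\tau(f))$. Universal cover. Fix $v_0\in V(\mathcal{G})$. A non-backtracking walk from $v_0$ is a finite (possibly empty) sequence $f_1,\dots,f_q$ of directed edges with $\sigma(f_1)=v_0$, $\tau(f_i)=\sigma(f_{i+1})$, $f_{i+1}\ne\check f_i$ (in particular a half-loop cannot be followed by itself). $\mathcal{T}$ is the tree whose vertices are these walks, two being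 adjacent when one is obtained from the other by appending one edge. $\Xi:\mathcal{T}\to\mathcal{G}$ sends a walk to its end vertex (the empty walk to $v_0$). The edge between $w$ and $wf$ has weight $a_f$, and $w$ has potential $b_{\Xi(w)}$; $A_{\mathcal{T}}$ is the Jacobi matrix of $\mathcal{T}$ with these coefficients. For $r\in V(\mathcal{G})$, $\mu_r$ is the probability measure with $\int x^k\,d\mu_r=\langle\delta_{\tilde r},A_{\mathcal{T}}^k\delta_{\tilde r}\rangle$ for all $k\ge0$, where $\tilde r$ is any vertex in $\Xi^{-1}(r)$. The density of states of $A_{\mathcal{T}}$ is $\frac1n\sum_{r\in V(\mathcal{G})}\mu_r$. Other notation. $\Delta_{ij}$ is the $n\times n$ matrix with a $1$ in entry $(i,j)$ and $0$ elsewhere. $C^*_{\mathrm{red}}(\Gamma_m)$ is the reduced group $C^*$-algebra, with canonical trace $\varphi(x)=\langle\delta_e,x\delta_e\rangle$ ($e$ the identity of $\Gamma_m$). The canonical conditional expectation is $E=\mathrm{Id}_{M_n(\mathbb{C})}\otimes\varphi$, i.e. $E[(x_{ij})]=(\varphi(x_{ij}))$. The spectral distribution of a self-adjoint element $X$ with respect to a state $\psi$ is the probability measure $\nu$ on $\mathbb{R}$ with $\int x^k\,d\nu=\psi(X^k)$ for all $k\ge0$. *)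

theory Defs
  imports
    "HOL-Probability.Probability"
    "HOL-Algebra.Generated_Groups"
    "HOL-Library.Function_Algebras"
    "Graph_Theory.Arc_Walk"
    "Graph_Theory.Digraph_Component"
begin

section \<open>Weighted graphs with half-loops\<close>

text \<open>
  The arcs of the digraph are the directed edges, \<open>tail\<close> and \<open>head\<close> are source and target, and
  \<open>rv\<close> is the edge reversal. Since every edge has a reversal, the graph is connected iff it is
  strongly connected as a digraph.
\<close>

locale jacobi_graph = fin_digraph G for G :: "('v, 'e) pre_digraph" +
  fixes rv :: "'e \<Rightarrow> 'e" and a :: "'e \<Rightarrow> real"
  assumes rv_arcs: "e \<in> arcs G \<Longrightarrow> rv e \<in> arcs G"
    and rv_rv: "e \<in> arcs G \<Longrightarrow> rv (rv e) = e"
    and tail_rv: "e \<in> arcs G \<Longrightarrow> tail G (rv e) = head G e"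
    and head_rv: "e \<in> arcs G \<Longrightarrow> head G (rv e) = tail G e"
    and connected: "strongly_connected G"
    and half_loops: "e \<in> arcs G \<Longrightarrow> tail G e = head G e \<Longrightarrow> rv e = e"
    and weight_rv: "e \<in> arcs G \<Longrightarrow> a (rv e) = a e"

definition edge_labelling ::
    "('v, 'e) pre_digraph \<Rightarrow> ('e \<Rightarrow> 'e) \<Rightarrow> nat \<Rightarrow> nat \<Rightarrow> (nat \<Rightarrow> 'e) \<Rightarrow> bool" where
  "edge_labelling G rv l m f \<longleftrightarrow>
     l \<le> m \<and>
     bij_betw f {1..l} {e \<in> arcs G. tail G e = head G e} \<and>
     bij_betw (\<lambda>i. {f i, rv (f i)}) {l + 1..m}
       ((\<lambda>e. {e, rv e}) ` {e \<in> arcs G. tail G e \<noteq> head G e})"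


section \<open>Square-summable functions and operators on them\<close>

definition ell2 :: "'a set \<Rightarrow> ('a \<Rightarrow> complex) set" where
  "ell2 S = {\<xi>. (\<forall>x. x \<notin> S \<longrightarrow> \<xi> x = 0) \<and> (\<lambda>x. (cmod (\<xi> x))\<^sup>2) summable_on UNIV}"

definition ell2_inner :: "('a \<Rightarrow> complex) \<Rightarrow> ('a \<Rightarrow> complex) \<Rightarrow> complex" where
  "ell2_inner \<xi> \<eta> = (\<Sum>\<^sub>\<infinity>x. cnj (\<xi> x) * \<eta> x)"

definition ell2_norm :: "('a \<Rightarrow> complex) \<Rightarrow> real" where
  "ell2_norm \<xi> = sqrt (\<Sum>\<^sub>\<infinity>x. (cmod (\<xi> x))\<^sup>2)"

definition delta :: "'a \<Rightarrow> 'a \<Rightarrow> complex" where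
  "delta x = (\<lambda>y. if y = x then 1 else 0)"

text \<open>
  An operator on \<^term>\<open>ell2 S\<close> is a function on all of \<open>'a \<Rightarrow> complex\<close>, normalised to be \<open>0\<close> outside
  \<^term>\<open>ell2 S\<close>. Sums and differences of operators are the pointwise ones of
  \<^theory>\<open>HOL-Library.Function_Algebras\<close>; the product of operators is composition, never the
  pointwise product.
\<close>

type_synonym 'a ell2_op = "('a \<Rightarrow> complex) \<Rightarrow> ('a \<Rightarrow> complex)"

definition op_scale :: "complex \<Rightarrow> 'a ell2_op \<Rightarrow> 'a ell2_op" where
  "op_scale c T = (\<lambda>\<xi> x. c * T \<xi> x)"

definition op_id :: "'a set \<Rightarrow> 'a ell2_op" where
  "op_id S = (\<lambda>\<xi>. if \<xi> \<in> ell2 S then \<xi> else 0)"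

definition bounded_ops :: "'a set \<Rightarrow> 'a ell2_op set" where
  "bounded_ops S = {T.
     (\<forall>\<xi>. \<xi> \<notin> ell2 S \<longrightarrow> T \<xi> = 0) \<and>
     (\<forall>\<xi>\<in>ell2 S. T \<xi> \<in> ell2 S) \<and>
     (\<forall>\<xi>\<in>ell2 S. \<forall>\<eta>\<in>ell2 S. T (\<xi> + \<eta>) = T \<xi> + T \<eta>) \<and>
     (\<forall>c. \<forall>\<xi>\<in>ell2 S. T (\<lambda>x. c * \<xi> x) = (\<lambda>x. c * T \<xi> x)) \<and>
     (\<exists>C. \<forall>\<xi>\<in>ell2 S. ell2_norm (T \<xi>) \<le> C * ell2_norm \<xi>)}"

definition op_norm :: "'a set \<Rightarrow> 'a ell2_op \<Rightarrow> real" where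
  "op_norm S T = (SUP \<xi>\<in>{\<xi> \<in> ell2 S. ell2_norm \<xi> \<le> 1}. ell2_norm (T \<xi>))"

definition jacobi_operator ::
    "('v, 'e) pre_digraph \<Rightarrow> ('e \<Rightarrow> real) \<Rightarrow> ('v \<Rightarrow> real) \<Rightarrow> 'v ell2_op" where
  "jacobi_operator G a b = (\<lambda>\<xi>. if \<xi> \<in> ell2 (verts G)
     then (\<lambda>u. if u \<in> verts G
       then of_real (b u) * \<xi> u + (\<Sum>f\<in>out_arcs G u. of_real (a f) * \<xi> (head G f)) else 0)
     else 0)"


section \<open>Spectral distributions\<close>

definition measure_with_moments :: "(nat \<Rightarrow> complex) \<Rightarrow> real measure \<Rightarrow> bool" where
  "measure_with_moments c \<nu> \<longleftrightarrow> real_distribution \<nu> \<and>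
     (\<forall>k. integrable \<nu> (\<lambda>x. x ^ k) \<and> complex_of_real (\<integral>x. x ^ k \<partial>\<nu>) = c k)"


section \<open>The universal cover\<close>

definition nonbacktracking_walks :: "('v, 'e) pre_digraph \<Rightarrow> ('e \<Rightarrow> 'e) \<Rightarrow> 'v \<Rightarrow> 'e list set" where
  "nonbacktracking_walks G rv v0 =
     {w. (\<exists>v. pre_digraph.awalk G v0 w v) \<and> successively (\<lambda>e f. f \<noteq> rv e) w}"

definition cover_proj :: "('v, 'e) pre_digraph \<Rightarrow> 'v \<Rightarrow> 'e list \<Rightarrow> 'v" where
  "cover_proj G v0 w = (if w = [] then v0 else head G (last w))"

text \<open>A directed edge of the tree is an ordered pair of adjacent vertices.\<close>

definition universal_cover ::
    "('v, 'e) pre_digraph \<Rightarrow> ('e \<Rightarrow> 'e) \<Rightarrow> 'v \<Rightarrow> ('e list, 'e list \<times> 'e list) pre_digraph" where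
  "universal_cover G rv v0 =
     \<lparr>verts = nonbacktracking_walks G rv v0,
      arcs = {(w, w'). w \<in> nonbacktracking_walks G rv v0 \<and> w' \<in> nonbacktracking_walks G rv v0 \<and>
                (\<exists>f. w' = w @ [f] \<or> w = w' @ [f])},
      tail = fst,
      head = snd\<rparr>"

definition cover_weight :: "('e \<Rightarrow> real) \<Rightarrow> 'e list \<times> 'e list \<Rightarrow> real" where
  "cover_weight a = (\<lambda>(w, w'). a (last (if length w < length w' then w' else w)))"

definition cover_operator ::
    "('v, 'e) pre_digraph \<Rightarrow> ('e \<Rightarrow> 'e) \<Rightarrow> ('e \<Rightarrow> real) \<Rightarrow> ('v \<Rightarrow> real) \<Rightarrow> 'v \<Rightarrow> 'e list ell2_op" where
  "cover_operator G rv a b v0 =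
     jacobi_operator (universal_cover G rv v0) (cover_weight a) (\<lambda>w. b (cover_proj G v0 w))"

text \<open>
  The moments are required for every vertex of the fibre over \<open>r\<close>, so the definite description
  includes the independence of the chosen preimage of \<open>r\<close>.
\<close>

definition cover_spectral_measure ::
    "('v, 'e) pre_digraph \<Rightarrow> ('e \<Rightarrow> 'e) \<Rightarrow> ('e \<Rightarrow> real) \<Rightarrow> ('v \<Rightarrow> real) \<Rightarrow> 'v \<Rightarrow> 'v \<Rightarrow> real measure" where
  "cover_spectral_measure G rv a b v0 r =
     (THE \<nu>. \<forall>w \<in> verts (universal_cover G rv v0). cover_proj G v0 w = r \<longrightarrow>
        measure_with_moments
          (\<lambda>k. ell2_inner (delta w) ((cover_operator G rv a b v0 ^^ k) (delta w))) \<nu>)"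

definition density_of_states ::
    "('v, 'e) pre_digraph \<Rightarrow> ('e \<Rightarrow> 'e) \<Rightarrow> ('e \<Rightarrow> real) \<Rightarrow> ('v \<Rightarrow> real) \<Rightarrow> 'v \<Rightarrow> real measure" where
  "density_of_states G rv a b v0 = measure_of UNIV (sets borel)
     (\<lambda>B. (\<Sum>r\<in>verts G. emeasure (cover_spectral_measure G rv a b v0 r) B) / of_nat (card (verts G)))"


section \<open>Free products of copies of the group of order two\<close>

text \<open>
  The elements are the reduced words, i.e. the words in \<open>1, \<dots>, m\<close> without equal adjacent letters;
  the letter \<open>i\<close> stands for the nontrivial element of the \<open>i\<close>-th factor.
\<close>

fun push :: "nat \<Rightarrow> nat list \<Rightarrow> nat list" where
  "push i [] = [i]"
| "push i (j # w) = (if i = j then w else i # j # w)"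

definition Z2_free_product :: "nat \<Rightarrow> nat list monoid" where
  "Z2_free_product m =
     \<lparr>carrier = {w. set w \<subseteq> {1..m} \<and> distinct_adj w}, mult = foldr push, one = []\<rparr>"

lemma distinct_adj_push: "distinct_adj w \<Longrightarrow> distinct_adj (push i w)"
  by (cases w) (auto dest: distinct_adj_ConsD)

lemma set_push: "set (push i w) \<subseteq> insert i (set w)"
  by (cases w) auto

lemma push_push: "distinct_adj w \<Longrightarrow> push i (push i w) = w"
  by (cases w rule: remdups_adj.cases) auto

lemma distinct_adj_foldr_push: "distinct_adj v \<Longrightarrow> distinct_adj (foldr push u v)"
  by (induction u) (auto intro: distinct_adj_push)

lemma set_foldr_push: "set (foldr push u v) \<subseteq> set u \<union> set v"
proof (induction u)
  case (Cons i u)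
  then show ?case using set_push[of i "foldr push u v"] by auto
qed simp

lemma foldr_push_push:
  "distinct_adj v \<Longrightarrow> foldr push (push i u) v = push i (foldr push u v)"
  by (cases u) (auto simp: push_push distinct_adj_foldr_push)

lemma foldr_push_assoc:
  "distinct_adj w \<Longrightarrow> foldr push (foldr push u v) w = foldr push u (foldr push v w)"
  by (induction u) (auto simp: foldr_push_push)

lemma foldr_push_rev: "foldr push (rev u) u = []"
  by (induction u) auto

lemma foldr_push_Nil: "distinct_adj u \<Longrightarrow> foldr push u [] = u"
proof (induction u)
  case (Cons i u)
  then show ?case by (cases u) (auto dest: distinct_adj_ConsD)
qed simp

lemma group_Z2_free_product: "group (Z2_free_product m)"
proof (rule groupI)
  fix x assume "x \<in> carrier (Z2_free_product m)"
  then show "\<exists>y\<in>carrier (Z2_free_product m). y \<otimes>\<^bsub>Z2_free_product m\<^esub> x = \<one>\<^bsub>Z2_free_product m\<^esub>"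
    by (intro bexI[of _ "rev x"]) (auto simp: Z2_free_product_def foldr_push_rev)
next
  fix x y assume "x \<in> carrier (Z2_free_product m)" "y \<in> carrier (Z2_free_product m)"
  then show "x \<otimes>\<^bsub>Z2_free_product m\<^esub> y \<in> carrier (Z2_free_product m)"
    using set_foldr_push[of x y] by (auto simp: Z2_free_product_def distinct_adj_foldr_push)
qed (auto simp: Z2_free_product_def foldr_push_assoc)

text \<open>The universal property of the free product of \<open>m\<close> copies of the group of order two.\<close>

lemma Z2_free_product_generators:
  assumes "i \<in> {1..m}"
  shows "[i] \<in> carrier (Z2_free_product m)"
    and "[i] \<noteq> \<one>\<^bsub>Z2_free_product m\<^esub>"
    and "[i] \<otimes>\<^bsub>Z2_free_product m\<^esub> [i] = \<one>\<^bsub>Z2_free_product m\<^esub>"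
  using assms by (auto simp: Z2_free_product_def)

lemma Z2_free_product_generated:
  "carrier (Z2_free_product m) = generate (Z2_free_product m) ((\<lambda>i. [i]) ` {1..m})"
proof -
  have "w \<in> carrier (Z2_free_product m) \<Longrightarrow>
      w \<in> generate (Z2_free_product m) ((\<lambda>i. [i]) ` {1..m})" for w
  proof (induction w)
    case Nil
    then show ?case
      using generate.one[of "Z2_free_product m"] by (simp add: Z2_free_product_def)
  next
    case (Cons i w)
    then have "w \<in> generate (Z2_free_product m) ((\<lambda>i. [i]) ` {1..m})" "i \<in> {1..m}"
      by (auto simp: Z2_free_product_def dest: distinct_adj_ConsD)
    then have "[i] \<otimes>\<^bsub>Z2_free_product m\<^esub> w \<in> generate (Z2_free_product m) ((\<lambda>i. [i]) ` {1..m})"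
      by (intro generate.eng[OF generate.incl]) auto
    moreover have "[i] \<otimes>\<^bsub>Z2_free_product m\<^esub> w = i # w"
      using Cons.prems by (cases w) (auto simp: Z2_free_product_def)
    ultimately show ?case by simp
  qed
  moreover have "generate (Z2_free_product m) ((\<lambda>i. [i]) ` {1..m}) \<subseteq> carrier (Z2_free_product m)"
    by (rule group.generate_incl[OF group_Z2_free_product])
      (auto simp: Z2_free_product_def)
  ultimately show ?thesis by blast
qed

lemma Z2_free_product_universal:
  assumes "group H" and h: "\<And>i. i \<in> {1..m} \<Longrightarrow> h i \<in> carrier H"
    and hh: "\<And>i. i \<in> {1..m} \<Longrightarrow> h i \<otimes>\<^bsub>H\<^esub> h i = \<one>\<^bsub>H\<^esub>"
  shows "\<exists>\<phi>\<in>hom (Z2_free_product m) H. \<forall>i\<in>{1..m}. \<phi> [i] = h i"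
proof -
  interpret H: group H by fact
  define \<phi> where "\<phi> = (\<lambda>w. foldr (\<lambda>i y. h i \<otimes>\<^bsub>H\<^esub> y) w \<one>\<^bsub>H\<^esub>)"
  have \<phi>_Nil: "\<phi> [] = \<one>\<^bsub>H\<^esub>" and \<phi>_Cons: "\<phi> (i # w) = h i \<otimes>\<^bsub>H\<^esub> \<phi> w" for i w
    by (simp_all add: \<phi>_def)
  have closed: "set w \<subseteq> {1..m} \<Longrightarrow> \<phi> w \<in> carrier H" for w
    by (induction w) (auto simp: \<phi>_Nil \<phi>_Cons h)
  have push: "\<phi> (push i w) = h i \<otimes>\<^bsub>H\<^esub> \<phi> w" if "i \<in> {1..m}" "set w \<subseteq> {1..m}" for i w
  proof (cases w)
    case (Cons j v)
    have "h i \<otimes>\<^bsub>H\<^esub> (h i \<otimes>\<^bsub>H\<^esub> \<phi> v) = \<phi> v" if "i = j"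
      using that \<open>i \<in> {1..m}\<close> \<open>set w \<subseteq> {1..m}\<close> Cons closed[of v]
      by (simp add: h hh flip: H.m_assoc)
    then show ?thesis using Cons by (auto simp: \<phi>_Cons)
  qed (simp add: \<phi>_Nil \<phi>_Cons)
  have mult: "\<phi> (foldr push u v) = \<phi> u \<otimes>\<^bsub>H\<^esub> \<phi> v" if "set u \<subseteq> {1..m}" "set v \<subseteq> {1..m}" for u v
    using that(1)
  proof (induction u)
    case Nil
    then show ?case using closed[OF that(2)] by (simp add: \<phi>_Nil)
  next
    case (Cons i u)
    then have "set (foldr push u v) \<subseteq> {1..m}"
      using set_foldr_push[of u v] that(2) by auto
    then show ?case
      using Cons closed[of u] closed[OF that(2)] by (simp add: push \<phi>_Cons h H.m_assoc)
  qed
  have "\<phi> \<in> hom (Z2_free_product m) H"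
    by (rule homI) (auto simp: Z2_free_product_def closed mult)
  moreover have "\<phi> [i] = h i" if "i \<in> {1..m}" for i
    using h[OF that] by (simp add: \<phi>_Nil \<phi>_Cons)
  ultimately show ?thesis by blast
qed


section \<open>The reduced group C*-algebra and matrices over it\<close>

definition left_regular :: "('g, 'm) monoid_scheme \<Rightarrow> 'g \<Rightarrow> 'g ell2_op" where
  "left_regular \<Gamma> g = (\<lambda>\<xi>. if \<xi> \<in> ell2 (carrier \<Gamma>)
     then (\<lambda>h. if h \<in> carrier \<Gamma> then \<xi> (inv\<^bsub>\<Gamma>\<^esub> g \<otimes>\<^bsub>\<Gamma>\<^esub> h) else 0)
     else 0)"

text \<open>The closure in operator norm of the linear span of the operators \<^term>\<open>left_regular \<Gamma> g\<close>.\<close>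

definition reduced_group_algebra :: "('g, 'm) monoid_scheme \<Rightarrow> 'g ell2_op set" where
  "reduced_group_algebra \<Gamma> = {T \<in> bounded_ops (carrier \<Gamma>).
     \<forall>\<epsilon>>0. \<exists>F c. finite F \<and> F \<subseteq> carrier \<Gamma> \<and>
       op_norm (carrier \<Gamma>) (T - (\<Sum>g\<in>F. op_scale (c g) (left_regular \<Gamma> g))) < \<epsilon>}"

definition canonical_trace :: "('g, 'm) monoid_scheme \<Rightarrow> 'g ell2_op \<Rightarrow> complex" where
  "canonical_trace \<Gamma> T = ell2_inner (delta \<one>\<^bsub>\<Gamma>\<^esub>) (T (delta \<one>\<^bsub>\<Gamma>\<^esub>))"

text \<open>
  The tensor product of the \<open>n \<times> n\<close> matrices with an algebra of operators is the algebra of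
  \<open>n \<times> n\<close> matrices of operators, \<open>B \<otimes> T\<close> being the matrix with entries \<open>B\<^sub>i\<^sub>j T\<close>.
\<close>

definition matrices_over :: "'a set \<Rightarrow> ('a ^ 'n ^ 'n) set" where
  "matrices_over A = {X. \<forall>i j. X $ i $ j \<in> A}"

definition matrix_tensor :: "complex ^ 'n ^ 'n \<Rightarrow> 'g ell2_op \<Rightarrow> 'g ell2_op ^ 'n ^ 'n" where
  "matrix_tensor B T = (\<chi> i j. op_scale (B $ i $ j) T)"

definition op_matrix_mult ::
    "'g ell2_op ^ 'n ^ 'n \<Rightarrow> 'g ell2_op ^ 'n ^ 'n \<Rightarrow> 'g ell2_op ^ 'n ^ 'n" where
  "op_matrix_mult X Y = (\<chi> i j. \<Sum>k\<in>UNIV. X $ i $ k \<circ> Y $ k $ j)"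

definition op_matrix_power ::
    "'g set \<Rightarrow> 'g ell2_op ^ 'n ^ 'n \<Rightarrow> nat \<Rightarrow> 'g ell2_op ^ 'n ^ 'n" where
  "op_matrix_power S X k = (op_matrix_mult X ^^ k) (matrix_tensor (mat 1) (op_id S))"

definition conditional_expectation ::
    "('g, 'm) monoid_scheme \<Rightarrow> 'g ell2_op ^ 'n ^ 'n \<Rightarrow> complex ^ 'n ^ 'n" where
  "conditional_expectation \<Gamma> X = (\<chi> i j. canonical_trace \<Gamma> (X $ i $ j))"

definition is_spectral_distribution ::
    "('g, 'm) monoid_scheme \<Rightarrow> ('g ell2_op ^ 'n ^ 'n \<Rightarrow> complex) \<Rightarrow> 'g ell2_op ^ 'n ^ 'n
      \<Rightarrow> real measure \<Rightarrow> bool" where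
  "is_spectral_distribution \<Gamma> \<psi> X \<nu> \<longleftrightarrow>
     measure_with_moments (\<lambda>k. \<psi> (op_matrix_power (carrier \<Gamma>) X k)) \<nu>"

definition matrix_unit :: "'n \<Rightarrow> 'n \<Rightarrow> complex ^ 'n ^ 'n" where
  "matrix_unit i j = (\<chi> k k'. if k = i \<and> k' = j then 1 else 0)"

definition graph_element ::
    "('n::finite, 'e) pre_digraph \<Rightarrow> ('e \<Rightarrow> 'e) \<Rightarrow> ('e \<Rightarrow> real) \<Rightarrow> ('n \<Rightarrow> real) \<Rightarrow> nat \<Rightarrow> nat
      \<Rightarrow> (nat \<Rightarrow> 'e) \<Rightarrow> nat list ell2_op ^ 'n ^ 'n" where
  "graph_element G rv a b l m f =
     (\<Sum>i\<in>UNIV. matrix_tensor (b i *\<^sub>R matrix_unit i i) (op_id (carrier (Z2_free_product m)))) +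
     (\<Sum>i=1..l. matrix_tensor (a (f i) *\<^sub>R matrix_unit (tail G (f i)) (head G (f i)))
        (left_regular (Z2_free_product m) [i])) +
     (\<Sum>i=l+1..m. matrix_tensor
        (a (f i) *\<^sub>R matrix_unit (tail G (f i)) (head G (f i)) +
         a (rv (f i)) *\<^sub>R matrix_unit (tail G (rv (f i))) (head G (rv (f i))))
        (left_regular (Z2_free_product m) [i]))"

end

theory Submission
  imports Defs "HOL-Real_Asymp.Real_Asymp"
begin

text \<open>
  All three claims come from a single graph. Let \<open>\<Gamma>\<close> be the free product, realised by reduced words,
  and give every directed edge \<open>e\<close> the letter \<open>lab e\<close> of its undirected edge. On \<open>V \<times> \<Gamma>\<close> join
  \<open>(u, h)\<close> to \<open>(head e, lab e \<cdot> h)\<close> for every edge \<open>e\<close> starting at \<open>u\<close>, with weight \<open>a e\<close>, and put the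
  potential \<open>b u\<close> at \<open>(u, h)\<close>. The entries of \<open>X\<close> are exactly the blocks of the Jacobi operator
  \<open>group_jacobi\<close> of this graph, so column \<open>j\<close> of \<open>X\<^sup>k\<close> applied to \<open>\<delta>\<^sub>1\<close> is the \<open>k\<close>-th iterate of
  \<open>group_jacobi\<close> at the point mass of \<open>(j, 1)\<close> (\<open>graph_element_power_column\<close>), and \<open>E\<close> reads off its
  values where \<open>h = 1\<close>.

  The universal cover is a connected component of this graph. Since a letter determines its undirected
  edge, and half-loops are their own reversals, two consecutive steps along equal letters are always
  a step and its reversal. Hence sending a non-backtracking walk to its end vertex and its reversed
  sequence of letters (\<open>develop\<close>) is injective and carries the neighbours of a walk to the neighbours of
  its image. Therefore the iterates of the tree operator are the iterates of \<open>group_jacobi\<close> pulled back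
  along this map (\<open>tree_act_eq_group_jacobi\<close>), and nothing ever leaves its image
  (\<open>group_jacobi_vanishes\<close>). The only walk that is developed to the empty word is the
  empty walk, which makes \<open>E[X\<^sup>p]\<close> diagonal. Right translations of \<open>\<Gamma>\<close> are symmetries of the graph,
  so the moments of the tree operator at a vertex \<open>w\<close> depend only on the end vertex of \<open>w\<close>, and they are
  the diagonal entries of \<open>E[X\<^sup>k]\<close> (\<open>cover_moment\<close>).

  It remains to pass from moments to measures. The tree operator is given by a symmetric kernel whose
  rows are finite with bounded absolute sum \<open>C\<close>, so the functional \<open>p \<mapsto> \<langle>\<delta>, p(A) \<delta>\<rangle>\<close> is nonnegative on
  \<open>p\<^sup>2 (C \<plusminus> x)\<close>. Hausdorff's argument then produces a measure on \<open>[-C, C]\<close>: the values of the functional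
  on the Bernstein polynomials are the weights of discrete probability measures on a grid, and a weak
  limit of these has the required moments (\<open>representing_measure\<close>, \<open>spectral_measure_exists\<close>). Moments that grow
  at most like \<open>C\<^sup>k\<close> determine a distribution, because the power series of its characteristic function
  converges everywhere (\<open>measure_with_moments_unique\<close>). Averaging over the vertices gives the density
  of states (\<open>measure_with_moments_uniform_mixture\<close>).
\<close>

section \<open>Measures with exponentially bounded moments\<close>

text \<open>
  The growth condition makes the Taylor expansion of the characteristic function converge at every
  point, so the moments determine the characteristic function, hence the distribution by Levy's
  uniqueness theorem.
\<close>

lemma measure_with_moments_unique:
  assumes "measure_with_moments c \<mu>" and "measure_with_moments c \<nu>"
    and bound: "\<And>k. cmod (c k) \<le> C ^ k"
  shows "\<mu> = \<nu>"
proof -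
  have char: "(\<lambda>n. \<Sum>k\<le>2 * n. ((\<i> * t) ^ k / fact k) * c k) \<longlonglongrightarrow> char M t"
    if M: "measure_with_moments c M" for M t
  proof -
    interpret M: real_distribution M
      using M by (simp add: measure_with_moments_def)
    have int: "integrable M (\<lambda>x. x ^ k)" and mom: "complex_of_real (\<integral>x. x ^ k \<partial>M) = c k" for k
      using M by (simp_all add: measure_with_moments_def)
    \<comment> \<open>Only Taylor polynomials of even degree are used: then the absolute moment in the remainder is a
      moment, to which the bound applies.\<close>
    have le: "cmod (char M t - (\<Sum>k\<le>2 * n. ((\<i> * t) ^ k / fact k) * c k))
        \<le> 2 * ((\<bar>t\<bar> * C) ^ (2 * n) / fact (2 * n))" for n
    proof -
      have "cmod (char M t - (\<Sum>k\<le>2 * n. ((\<i> * t) ^ k / fact k) * c k))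
          \<le> (2 * \<bar>t\<bar> ^ (2 * n) / fact (2 * n)) * (\<integral>x. \<bar>x\<bar> ^ (2 * n) \<partial>M)"
        using M.char_approx1[of "2 * n" t] int by (simp add: mom)
      also have "(\<integral>x. \<bar>x\<bar> ^ (2 * n) \<partial>M) = (\<integral>x. x ^ (2 * n) \<partial>M)"
        by (simp add: power_even_abs)
      also have "\<dots> \<le> C ^ (2 * n)"
        using bound[of "2 * n"] unfolding mom[symmetric] norm_of_real by linarith
      finally show ?thesis
        by (simp add: power_mult_distrib mult_left_mono divide_right_mono)
    qed
    have "(\<lambda>n. (\<bar>t\<bar> * C) ^ n / fact n) \<longlonglongrightarrow> 0"
      using summable_LIMSEQ_zero[OF summable_exp[of "\<bar>t\<bar> * C"]] by (simp add: field_simps)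
    from LIMSEQ_subseq_LIMSEQ[OF this, of "\<lambda>n. 2 * n"]
    have "(\<lambda>n. (\<bar>t\<bar> * C) ^ (2 * n) / fact (2 * n)) \<longlonglongrightarrow> 0"
      by (simp add: strict_mono_def o_def)
    from tendsto_mult_right_zero[OF this, of 2]
    have "(\<lambda>n. cmod (char M t - (\<Sum>k\<le>2 * n. ((\<i> * t) ^ k / fact k) * c k))) \<longlonglongrightarrow> 0"
      by (rule tendsto_sandwich[OF always_eventually always_eventually tendsto_const, rotated 2])
        (use le in auto)
    then have "(\<lambda>n. char M t - (\<Sum>k\<le>2 * n. ((\<i> * t) ^ k / fact k) * c k)) \<longlonglongrightarrow> 0"
      by (rule tendsto_norm_zero_cancel)
    from tendsto_diff[OF tendsto_const[of "char M t"] this] show ?thesis by simp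
  qed
  show ?thesis
  proof (rule Levy_uniqueness)
    show "char \<mu> = char \<nu>"
      using char[OF assms(1)] char[OF assms(2)] by (intro ext) (rule LIMSEQ_unique)
  qed (use assms in \<open>auto simp: measure_with_moments_def\<close>)
qed

text \<open>
  Compact support is the source of the growth condition that uniqueness requires.
\<close>

lemma moments_bounded_by_support:
  assumes "measure_with_moments c \<nu>" and "AE x in \<nu>. \<bar>x\<bar> \<le> C"
  shows "cmod (c k) \<le> C ^ k"
proof -
  interpret real_distribution \<nu>
    using assms(1) by (simp add: measure_with_moments_def)
  have int: "integrable \<nu> (\<lambda>x. x ^ k)" and c: "c k = complex_of_real (\<integral>x. x ^ k \<partial>\<nu>)"
    using assms(1) by (simp_all add: measure_with_moments_def)
  have "\<bar>\<integral>x. x ^ k \<partial>\<nu>\<bar> \<le> (\<integral>x. \<bar>x ^ k\<bar> \<partial>\<nu>)"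
    by (rule integral_abs_bound)
  also have "\<dots> \<le> (\<integral>x. C ^ k \<partial>\<nu>)"
    using integrable_abs[OF int] assms(2)
    by (intro integral_mono_AE) (auto simp: power_abs elim!: eventually_mono intro: power_mono)
  also have "\<dots> = C ^ k" using prob_space by simp
  finally show ?thesis by (simp add: c norm_of_real)
qed

text \<open>
  The averaged measure is the law obtained by first choosing an index uniformly and then sampling from
  the chosen distribution; in the Giry monad this is a bind, which supplies countable additivity and
  the integrals of nonnegative functions.
\<close>

lemma measure_with_moments_uniform_mixture:
  fixes M :: "'i::finite \<Rightarrow> real measure"
  assumes M: "\<And>i. measure_with_moments (c i) (M i)"
  shows "measure_with_moments (\<lambda>k. (\<Sum>i\<in>UNIV. c i k) / of_nat CARD('i))
    (measure_of UNIV (sets borel) (\<lambda>B. (\<Sum>i\<in>UNIV. emeasure (M i) B) / of_nat CARD('i)))"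
proof -
  define n where "n = real CARD('i)"
  have n: "0 < n" by (simp add: n_def card_gt_0_iff)
  define U where "U = measure_pmf (pmf_of_set (UNIV :: 'i set))"
  interpret M: real_distribution "M i" for i
    using M by (simp add: measure_with_moments_def)
  have meas: "M \<in> measurable U (subprob_algebra borel)"
    by (rule measurableI)
      (auto simp: U_def space_subprob_algebra M.prob_space_axioms intro: prob_space_imp_subprob_space)
  define N where "N = U \<bind> M"
  have sets_N: "sets N = sets borel"
    unfolding N_def by (subst sets_bind[of _ _ borel]) (auto simp: U_def)
  have space_N: "space N = UNIV" using sets_eq_imp_space_eq[OF sets_N] by simp
  have nn: "(\<integral>\<^sup>+x. g x \<partial>N) = (\<Sum>i\<in>UNIV. \<integral>\<^sup>+x. g x \<partial>M i) / of_nat CARD('i)"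
    if "g \<in> borel_measurable borel" for g
    unfolding N_def nn_integral_bind[OF that meas] unfolding U_def
    by (subst nn_integral_pmf_of_set) auto
  have "emeasure N B = (\<Sum>i\<in>UNIV. emeasure (M i) B) / of_nat CARD('i)" if "B \<in> sets borel" for B
    using nn[of "indicator B"] that sets_N by (simp add: nn_integral_indicator)
  then have "measure_of UNIV (sets borel) (\<lambda>B. (\<Sum>i\<in>UNIV. emeasure (M i) B) / of_nat CARD('i)) =
      measure_of UNIV (sets borel) (emeasure N)"
    using sets.sigma_sets_eq[of "borel :: real measure"] by (intro measure_of_eq) auto
  also have "\<dots> = N"
    using measure_of_of_measure[of N] by (simp add: space_N sets_N)
  finally have N: "measure_of UNIV (sets borel) (\<lambda>B. (\<Sum>i\<in>UNIV. emeasure (M i) B) / of_nat CARD('i)) = N" .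
  have nonneg: "has_bochner_integral N g ((\<Sum>i\<in>UNIV. \<integral>x. g x \<partial>M i) / n)"
    if g: "g \<in> borel_measurable borel" "\<And>x. 0 \<le> g x" "\<And>i. integrable (M i) g" for g :: "real \<Rightarrow> real"
  proof (rule has_bochner_integral_nn_integral)
    show "g \<in> borel_measurable N" using g(1) sets_N by (simp cong: measurable_cong_sets)
    have int_nonneg: "0 \<le> (\<integral>x. g x \<partial>M i)" for i using g(2) by simp
    show "0 \<le> (\<Sum>i\<in>UNIV. \<integral>x. g x \<partial>M i) / n"
      using n int_nonneg by (intro divide_nonneg_pos sum_nonneg) auto
    have "(\<integral>\<^sup>+x. ennreal (g x) \<partial>N) = (\<Sum>i\<in>UNIV. ennreal (\<integral>x. g x \<partial>M i)) / of_nat CARD('i)"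
      using g by (subst nn) (auto simp: nn_integral_eq_integral)
    also have "\<dots> = ennreal (\<Sum>i\<in>UNIV. \<integral>x. g x \<partial>M i) / ennreal n"
      using int_nonneg by (simp add: sum_ennreal n_def ennreal_of_nat_eq_real_of_nat)
    also have "\<dots> = ennreal ((\<Sum>i\<in>UNIV. \<integral>x. g x \<partial>M i) / n)"
      using n int_nonneg by (simp add: divide_ennreal sum_nonneg)
    finally show "(\<integral>\<^sup>+x. ennreal (g x) \<partial>N) = ennreal ((\<Sum>i\<in>UNIV. \<integral>x. g x \<partial>M i) / n)" .
  qed (use g in auto)
  have moment: "has_bochner_integral N (\<lambda>x. x ^ k) ((\<Sum>i\<in>UNIV. \<integral>x. x ^ k \<partial>M i) / n)" for k
  proof -
    have int: "integrable (M i) (\<lambda>x. x ^ k)" for i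
      using M by (simp add: measure_with_moments_def)
    have pos: "integrable (M i) (\<lambda>x. max 0 (x ^ k))" and neg: "integrable (M i) (\<lambda>x. max 0 (- (x ^ k)))" for i
      using int by auto
    have "has_bochner_integral N (\<lambda>x. max 0 (x ^ k) - max 0 (- (x ^ k)))
        ((\<Sum>i\<in>UNIV. \<integral>x. max 0 (x ^ k) \<partial>M i) / n - (\<Sum>i\<in>UNIV. \<integral>x. max 0 (- (x ^ k)) \<partial>M i) / n)"
      using pos neg by (intro has_bochner_integral_diff nonneg) auto
    moreover have "(\<lambda>x::real. max 0 (x ^ k) - max 0 (- (x ^ k))) = (\<lambda>x. x ^ k)" by (auto simp: max_def)
    moreover have "(\<integral>x. x ^ k \<partial>M i) = (\<integral>x. max 0 (x ^ k) \<partial>M i) - (\<integral>x. max 0 (- (x ^ k)) \<partial>M i)" for i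
      unfolding Bochner_Integration.integral_diff[OF pos neg, symmetric]
      by (rule Bochner_Integration.integral_cong) (auto simp: max_def)
    ultimately show ?thesis by (simp add: sum_subtractf diff_divide_distrib)
  qed
  have "prob_space N"
  proof
    show "emeasure N (space N) = 1"
      using nn[of "\<lambda>_. 1"] M.emeasure_space_1 n
      by (simp add: ennreal_of_nat_eq_real_of_nat divide_ennreal n_def)
  qed
  then have "real_distribution N"
    by (simp add: real_distribution_def real_distribution_axioms_def sets_N)
  moreover have "complex_of_real ((\<Sum>i\<in>UNIV. \<integral>x. x ^ k \<partial>M i) / n) = (\<Sum>i\<in>UNIV. c i k) / of_nat CARD('i)" for k
    using M by (simp add: measure_with_moments_def n_def)
  ultimately show ?thesis
    unfolding N using moment by (auto simp: measure_with_moments_def has_bochner_integral_iff)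
qed

section \<open>The moment problem on a bounded interval\<close>

text \<open>
  The Bernstein basis polynomial \<open>(n choose j) x\<^sup>j (1 - x)\<^sup>n\<^sup>-\<^sup>j\<close>.
\<close>

definition bernstein_poly :: "nat \<Rightarrow> nat \<Rightarrow> real poly" where
  "bernstein_poly n j = smult (of_nat (n choose j)) ([:0, 1:] ^ j * [:1, -1:] ^ (n - j))"

lemma sum_bernstein_poly: "(\<Sum>j\<le>n. bernstein_poly n j) = 1"
proof -
  have "[:0, 1:] + [:1, -1:] = (1 :: real poly)"
    by (simp add: one_pCons)
  then have "(1 :: real poly) = ([:0, 1:] + [:1, -1:]) ^ n"
    by (simp only: power_one)
  also have "\<dots> = (\<Sum>j\<le>n. bernstein_poly n j)"
    unfolding binomial_ring bernstein_poly_def by (simp add: of_nat_poly mult.assoc)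
  finally show ?thesis ..
qed

text \<open>
  The factorial moments of the binomial distribution with parameter \<open>x\<close>, as an identity of polynomials
  in \<open>x\<close>: choosing first \<open>j\<close> and then \<open>k\<close> of these is choosing first \<open>k\<close> and then \<open>j - k\<close> of the rest.
\<close>

lemma factorial_moment_bernstein_poly:
  assumes "k \<le> n"
  shows "(\<Sum>j\<le>n. smult (of_nat (j choose k)) (bernstein_poly n j)) =
    smult (of_nat (n choose k)) ([:0, 1:] ^ k)"
proof -
  have "(\<Sum>j\<le>n. smult (of_nat (j choose k)) (bernstein_poly n j)) =
      (\<Sum>j\<in>{k..n}. smult (of_nat (j choose k)) (bernstein_poly n j))"
    by (rule sum.mono_neutral_right) (auto simp: binomial_eq_0)
  also have "\<dots> = (\<Sum>j\<in>{k..n}. smult (of_nat (n choose k)) ([:0, 1:] ^ k * bernstein_poly (n - k) (j - k)))"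
  proof (rule sum.cong[OF refl])
    fix j assume j: "j \<in> {k..n}"
    then have "(n choose j) * (j choose k) = (n choose k) * ((n - k) choose (j - k))"
      by (intro choose_mult) auto
    then have "real (j choose k) * real (n choose j) = real (n choose k) * real ((n - k) choose (j - k))"
      by (metis mult.commute of_nat_mult)
    moreover have "[:0, 1:] ^ j = [:0, 1::real:] ^ k * [:0, 1:] ^ (j - k)"
      using j by (simp flip: power_add)
    moreover have "n - k - (j - k) = n - j" using j by auto
    ultimately show "smult (of_nat (j choose k)) (bernstein_poly n j) =
        smult (of_nat (n choose k)) ([:0, 1:] ^ k * bernstein_poly (n - k) (j - k))"
      by (simp add: bernstein_poly_def mult.assoc)
  qed
  also have "\<dots> = (\<Sum>i\<le>n - k. smult (of_nat (n choose k)) ([:0, 1:] ^ k * bernstein_poly (n - k) i))"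
    by (rule sum.reindex_bij_witness[of _ "\<lambda>i. i + k" "\<lambda>j. j - k"]) (use assms in auto)
  also have "\<dots> = smult (of_nat (n choose k)) ([:0, 1:] ^ k * (\<Sum>i\<le>n - k. bernstein_poly (n - k) i))"
  proof -
    have "smult c (sum p A) = (\<Sum>i\<in>A. smult c (p i))" for c and p :: "nat \<Rightarrow> real poly" and A
      by (induction A rule: infinite_finite_induct) (simp_all add: smult_add_right)
    then show ?thesis by (simp add: sum_distrib_left)
  qed
  finally show ?thesis by (simp add: sum_bernstein_poly)
qed

text \<open>
  The exact moments of Bernstein weights are factorial moments; this uniform estimate converts them
  into power moments on the grid \<open>j / n\<close>. Both sides are products of \<open>k\<close> factors of modulus at most
  one that are pairwise close.
\<close>

lemma binomial_ratio_approx: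
  assumes "j \<le> n" and "2 * k \<le> n" and "0 < n"
  shows "\<bar>real (j choose k) / real (n choose k) - (real j / real n) ^ k\<bar> \<le> real k * (real k / real (n - k))"
proof -
  define y where "y i = (real j - real i) / (real n - real i)" for i
  have close: "\<bar>y i - real j / real n\<bar> \<le> real k / real (n - k)" and le1: "\<bar>y i\<bar> \<le> 1" if "i < k" for i
  proof -
    have i: "i < n" using that assms by auto
    have "y i - real j / real n = - (real i * (real n - real j) / (real n * (real n - real i)))"
      using i \<open>0 < n\<close> by (simp add: y_def field_simps)
    also have "\<bar>\<dots>\<bar> = real i * (real n - real j) / (real n * (real n - real i))"
      using i assms by (simp add: abs_mult)
    also have "\<dots> \<le> real i * real n / (real n * (real n - real i))"
      using i assms by (intro divide_right_mono mult_left_mono) auto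
    also have "\<dots> = real i / (real n - real i)" using \<open>0 < n\<close> by simp
    also have "\<dots> \<le> real k / real (n - k)"
      using that assms i by (intro frac_le) auto
    finally show "\<bar>y i - real j / real n\<bar> \<le> real k / real (n - k)" .
    \<comment> \<open>The numerator is negative when \<open>j < i\<close>; then \<open>2 * k \<le> n\<close> keeps it below the denominator.\<close>
    show "\<bar>y i\<bar> \<le> 1"
      using i assms that by (auto simp: y_def abs_le_iff field_simps)
  qed
  have "real (j choose k) / real (n choose k) = (\<Prod>i<k. y i)"
    unfolding binomial_gbinomial gbinomial_prod_rev y_def
    by (simp add: prod_dividef atLeast0LessThan)
  moreover have "\<bar>(\<Prod>i<k. y i) - (\<Prod>i<k. real j / real n)\<bar> \<le> (\<Sum>i<k. \<bar>y i - real j / real n\<bar>)"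
    using norm_prod_diff[of "{..<k}" y "\<lambda>_. real j / real n"] le1 assms by simp
  moreover have "(\<Sum>i<k. \<bar>y i - real j / real n\<bar>) \<le> real k * (real k / real (n - k))"
    using sum_bounded_above[of "{..<k}" "\<lambda>i. \<bar>y i - real j / real n\<bar>" "real k / real (n - k)"] close
    by simp
  ultimately show ?thesis by simp
qed

text \<open>
  The positivity data of Hausdorff's moment problem on \<open>[0, 1]\<close>. Nonnegativity on \<open>p\<^sup>2 x\<close> and
  \<open>p\<^sup>2 (1 - x)\<close> is what an operator \<open>T\<close> with \<open>0 \<le> T \<le> 1\<close> provides for \<open>L p = \<langle>v, p(T) v\<rangle>\<close>.
\<close>

locale unit_interval_functional =
  fixes L :: "real poly \<Rightarrow> real"
  assumes L_add: "L (p + q) = L p + L q"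
    and L_smult: "L (smult c p) = c * L p"
    and L_1: "L 1 = 1"
    and L_square_X: "0 \<le> L (p * p * [:0, 1:])"
    and L_square_1_minus_X: "0 \<le> L (p * p * [:1, -1:])"
begin

lemma L_0: "L 0 = 0"
  using L_smult[of 0 0] by simp

lemma L_sum: "L (\<Sum>i\<in>I. p i) = (\<Sum>i\<in>I. L (p i))"
  by (induction I rule: infinite_finite_induct) (auto simp: L_0 L_add)

lemma L_square: "0 \<le> L (p * p)"
proof -
  have "p * p = p * p * [:0, 1:] + p * p * [:1, -1:]"
    unfolding distrib_left[symmetric] by (simp add: one_pCons)
  then have "L (p * p) = L (p * p * [:0, 1:]) + L (p * p * [:1, -1:])"
    by (metis L_add)
  with L_square_X[of p] L_square_1_minus_X[of p] show ?thesis by linarith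
qed

text \<open>
  Splitting off squares leaves one of the factors \<open>1\<close>, \<open>x\<close>, \<open>1 - x\<close>, \<open>x (1 - x)\<close>. Only the last is
  not covered by the axioms directly; it equals \<open>x\<^sup>2 (1 - x) + (1 - x)\<^sup>2 x\<close>.
\<close>

lemma L_powers_nonneg: "0 \<le> L ([:0, 1:] ^ j * [:1, -1:] ^ k)"
proof -
  define X Y :: "real poly" where "X = [:0, 1:]" and "Y = [:1, -1:]"
  define p where "p = X ^ (j div 2) * Y ^ (k div 2)"
  have XY: "X + Y = 1" by (simp add: X_def Y_def one_pCons)
  have pp: "p * p = X ^ (2 * (j div 2)) * Y ^ (2 * (k div 2))"
    by (simp add: p_def mult_2 power_add algebra_simps)
  have "X ^ j * Y ^ k = p * p * (X ^ (j mod 2) * Y ^ (k mod 2))"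
  proof -
    have "X ^ j = X ^ (2 * (j div 2)) * X ^ (j mod 2)" "Y ^ k = Y ^ (2 * (k div 2)) * Y ^ (k mod 2)"
      by (simp_all flip: power_add)
    then show ?thesis by (simp add: pp)
  qed
  moreover have "0 \<le> L (p * p * (X ^ (j mod 2) * Y ^ (k mod 2)))"
  proof -
    consider "j mod 2 = 0" "k mod 2 = 0" | "j mod 2 = 1" "k mod 2 = 0"
      | "j mod 2 = 0" "k mod 2 = 1" | "j mod 2 = 1" "k mod 2 = 1"
      by fastforce
    then show ?thesis
    proof cases
      case 4
      have "p * p * (X * Y) = p * p * (X * Y) * (X + Y)" by (simp add: XY)
      also have "\<dots> = (p * X) * (p * X) * Y + (p * Y) * (p * Y) * X"
        by (simp add: algebra_simps)
      finally have "L (p * p * (X * Y)) = L ((p * X) * (p * X) * Y) + L ((p * Y) * (p * Y) * X)"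
        by (simp only: L_add)
      then have "0 \<le> L (p * p * (X * Y))"
        using L_square_X[of "p * Y", folded X_def] L_square_1_minus_X[of "p * X", folded Y_def]
        by linarith
      then show ?thesis by (simp only: 4 power_one_right)
    qed (use L_square[of p] L_square_X[of p] L_square_1_minus_X[of p] in \<open>simp_all add: X_def Y_def\<close>)
  qed
  ultimately show ?thesis by (simp add: X_def Y_def)
qed

text \<open>
  The mass that the discrete approximation of the representing measure puts at \<open>j / n\<close>.
\<close>

definition weight :: "nat \<Rightarrow> nat \<Rightarrow> real" where
  "weight n j = (if j \<le> n then L (bernstein_poly n j) else 0)"

lemma weight_nonneg: "0 \<le> weight n j"
  by (auto simp: weight_def bernstein_poly_def L_smult L_powers_nonneg)

lemma sum_weight: "(\<Sum>j\<le>n. weight n j) = 1"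
  using L_sum[of "bernstein_poly n" "{..n}"] by (simp add: weight_def sum_bernstein_poly L_1)

lemma sum_weight_binomial_ratio:
  assumes "k \<le> n"
  shows "(\<Sum>j\<le>n. weight n j * (real (j choose k) / real (n choose k))) = L ([:0, 1:] ^ k)"
proof -
  have "(\<Sum>j\<le>n. weight n j * real (j choose k)) =
      L (\<Sum>j\<le>n. smult (of_nat (j choose k)) (bernstein_poly n j))"
    by (simp add: weight_def L_sum L_smult mult.commute)
  also have "\<dots> = real (n choose k) * L ([:0, 1:] ^ k)"
    by (simp add: factorial_moment_bernstein_poly[OF assms] L_smult)
  finally show ?thesis
    using assms by (simp add: field_simps flip: sum_divide_distrib)
qed

lemma sum_weight_power_tendsto:
  "(\<lambda>n. \<Sum>j\<le>n. weight n j * (real j / real n) ^ k) \<longlonglongrightarrow> L ([:0, 1:] ^ k)"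
proof -
  have le: "\<bar>(\<Sum>j\<le>n. weight n j * (real j / real n) ^ k) - L ([:0, 1:] ^ k)\<bar>
      \<le> real k * (real k / real (n - k))" if "n \<ge> 2 * k + 1" for n
  proof -
    have "\<bar>(\<Sum>j\<le>n. weight n j * (real j / real n) ^ k) - L ([:0, 1:] ^ k)\<bar> =
        \<bar>\<Sum>j\<le>n. weight n j * (real (j choose k) / real (n choose k) - (real j / real n) ^ k)\<bar>"
      using sum_weight_binomial_ratio[of k n] that
      by (simp add: right_diff_distrib sum_subtractf abs_minus_commute)
    also have "\<dots> \<le> (\<Sum>j\<le>n. weight n j * (real k * (real k / real (n - k))))"
    proof (intro order_trans[OF sum_abs] sum_mono)
      fix j assume "j \<in> {..n}"
      then show "\<bar>weight n j * (real (j choose k) / real (n choose k) - (real j / real n) ^ k)\<bar>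
          \<le> weight n j * (real k * (real k / real (n - k)))"
        unfolding abs_mult abs_of_nonneg[OF weight_nonneg]
        using that binomial_ratio_approx[of j n k] by (intro mult_left_mono weight_nonneg) auto
    qed
    also have "\<dots> = real k * (real k / real (n - k))"
      unfolding sum_distrib_right[symmetric] sum_weight by simp
    finally show ?thesis .
  qed
  have "(\<lambda>n. real k * (real k / real (n - k))) \<longlonglongrightarrow> 0"
    by real_asymp
  then have "(\<lambda>n. (\<Sum>j\<le>n. weight n j * (real j / real n) ^ k) - L ([:0, 1:] ^ k)) \<longlonglongrightarrow> 0"
    by (rule Lim_null_comparison[rotated])
      (use le in \<open>auto simp: eventually_sequentially intro!: exI[of _ "2 * k + 1"]\<close>)
  from tendsto_add[OF this tendsto_const[of "L ([:0, 1:] ^ k)"]] show ?thesis by simp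
qed

definition approx_pmf :: "nat \<Rightarrow> nat pmf" where
  "approx_pmf n = embed_pmf (weight n)"

lemma pmf_approx_pmf: "pmf (approx_pmf n) j = weight n j"
proof -
  have "(\<integral>\<^sup>+j. ennreal (weight n j) \<partial>count_space UNIV) = (\<integral>\<^sup>+j. ennreal (weight n j) \<partial>count_space {..n})"
    by (rule nn_integral_count_space_eq) (auto simp: weight_def)
  also have "\<dots> = ennreal (\<Sum>j\<le>n. weight n j)"
    by (simp add: nn_integral_count_space_finite sum_ennreal weight_nonneg)
  finally show ?thesis
    unfolding approx_pmf_def by (intro pmf_embed_pmf) (auto simp: weight_nonneg sum_weight)
qed

lemma set_approx_pmf: "set_pmf (approx_pmf n) \<subseteq> {..n}"
  by (auto simp: set_pmf_eq pmf_approx_pmf weight_def split: if_splits)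

definition approx_measure :: "nat \<Rightarrow> real measure" where
  "approx_measure n = distr (measure_pmf (approx_pmf n)) borel (\<lambda>j. real j / real n)"

lemma real_distribution_approx: "real_distribution (approx_measure n)"
  unfolding approx_measure_def by (rule prob_space.real_distribution_distr) (auto intro: measure_pmf.prob_space_axioms)

lemma integral_approx_measure:
  assumes "f \<in> borel_measurable borel"
  shows "(\<integral>x. f x \<partial>approx_measure n) = (\<Sum>j\<le>n. weight n j * f (real j / real n))"
proof -
  have "(\<integral>x. f x \<partial>approx_measure n) = (\<integral>j. f (real j / real n) \<partial>measure_pmf (approx_pmf n))"
    unfolding approx_measure_def using assms by (intro integral_distr) auto
  also have "\<dots> = (\<Sum>j\<le>n. weight n j * f (real j / real n))"
    using set_approx_pmf[of n] by (subst integral_measure_pmf[of "{..n}"]) (auto simp: pmf_approx_pmf)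
  finally show ?thesis .
qed

lemma tight_approx_measure: "tight approx_measure"
proof -
  have "1 - \<epsilon> < measure (approx_measure n) {-1<..1}" if "0 < \<epsilon>" for \<epsilon> :: real and n
  proof -
    have "measure (approx_measure n) {-1<..1} =
        measure (measure_pmf (approx_pmf n)) ((\<lambda>j. real j / real n) -` {-1<..1})"
      by (simp add: approx_measure_def measure_distr)
    also have "\<dots> = 1"
    proof (rule measure_pmf.prob_eq_1[THEN iffD2])
      show "AE j in measure_pmf (approx_pmf n). j \<in> (\<lambda>j. real j / real n) -` {-1<..1}"
        unfolding AE_measure_pmf_iff
      proof
        fix j assume "j \<in> set_pmf (approx_pmf n)"
        then have "j \<le> n" using set_approx_pmf by auto
        then have "0 \<le> real j / real n" "real j / real n \<le> 1"
          by (auto simp: divide_le_eq_1)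
        then show "j \<in> (\<lambda>j. real j / real n) -` {-1<..1}"
          by (auto intro: less_le_trans[of "-1" 0])
      qed
    qed simp
    finally show ?thesis using that by simp
  qed
  then show ?thesis
    unfolding tight_def using real_distribution_approx
    by (intro conjI allI impI exI[of _ "-1"] exI[of _ 1]) auto
qed

text \<open>
  All discrete approximations live on \<open>[0, 1]\<close>, so they are tight and a subsequence converges weakly.
  Its limit has the right moments because the moments of the approximations converge to the values
  of \<open>L\<close>.
\<close>

theorem representing_measure:
  "\<exists>\<nu>. real_distribution \<nu> \<and> (AE x in \<nu>. 0 \<le> x \<and> x \<le> 1) \<and>
     (\<forall>p. integrable \<nu> (poly p) \<and> (\<integral>x. poly p x \<partial>\<nu>) = L p)"
proof -
  obtain r \<nu> where r: "strict_mono r" and \<nu>: "real_distribution \<nu>"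
    and conv: "weak_conv_m (approx_measure \<circ> id \<circ> r) \<nu>"
    using tight_imp_convergent_subsubsequence[OF tight_approx_measure strict_mono_id] by blast
  interpret \<nu>: real_distribution \<nu> by fact
  \<comment> \<open>Weak convergence only tests bounded continuous functions, so powers are replaced by powers of the
    truncation to \<open>[0, 1]\<close>, with which they agree on the grid.\<close>
  define clamp :: "real \<Rightarrow> real" where "clamp x = max 0 (min 1 x)" for x
  have clamp_cont: "isCont clamp x" for x
    unfolding clamp_def by (intro continuous_intros)
  have clamp_bound: "\<bar>clamp x\<bar> \<le> 1" for x by (auto simp: clamp_def)
  have clamp_grid: "clamp (real j / real n) = real j / real n" if "j \<le> n" for j n
    using that by (cases "n = 0") (auto simp: clamp_def)
  have limit: "(\<lambda>n. \<integral>x. g x \<partial>approx_measure (r n)) \<longlonglongrightarrow> (\<integral>x. g x \<partial>\<nu>)"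
    if "\<And>x. isCont g x" "\<And>x. \<bar>g x\<bar> \<le> B" for g :: "real \<Rightarrow> real" and B
    using weak_conv_imp_integral_bdd_continuous_conv[OF _ \<nu> conv, of g B] real_distribution_approx that
    by simp
  have borel: "g \<in> borel_measurable borel" if "\<And>x. isCont g x" for g :: "real \<Rightarrow> real"
    using that by (intro borel_measurable_continuous_onI continuous_at_imp_continuous_on) auto
  \<comment> \<open>The limit is supported in \<open>[0, 1]\<close>: the truncated distance to the interval integrates to \<open>0\<close>.\<close>
  have "AE x in \<nu>. min 1 \<bar>x - clamp x\<bar> = 0"
  proof -
    define g where "g x = min 1 \<bar>x - clamp x\<bar>" for x
    have g: "isCont g x" "\<bar>g x\<bar> \<le> 1" for x
      using clamp_cont unfolding g_def by (auto intro!: continuous_intros)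
    have "(\<integral>x. g x \<partial>approx_measure n) = 0" for n
      unfolding integral_approx_measure[OF borel[OF g(1)]]
      by (rule sum.neutral) (auto simp: g_def clamp_grid)
    with limit[OF g] have "(\<integral>x. g x \<partial>\<nu>) = 0"
      by (simp add: LIMSEQ_const_iff)
    moreover have "integrable \<nu> g"
      using g borel[OF g(1)] by (intro \<nu>.integrable_const_bound[of _ 1]) auto
    ultimately have "AE x in \<nu>. g x = 0"
      by (subst (asm) integral_nonneg_eq_0_iff_AE) (auto simp: g_def)
    then show ?thesis by (simp add: g_def)
  qed
  then have ae: "AE x in \<nu>. x = clamp x" by (auto elim!: eventually_mono)
  have powers: "integrable \<nu> (\<lambda>x. x ^ k)" "(\<integral>x. x ^ k \<partial>\<nu>) = L ([:0, 1:] ^ k)" for k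
  proof -
    define g where "g x = clamp x ^ k" for x
    have g: "isCont g x" "\<bar>g x\<bar> \<le> 1" for x
      using clamp_cont clamp_bound unfolding g_def
      by (auto intro!: continuous_intros simp: power_abs power_le_one)
    have "integrable \<nu> g"
      using g borel[OF g(1)] by (intro \<nu>.integrable_const_bound[of _ 1]) auto
    moreover have ae_g: "AE x in \<nu>. g x = x ^ k"
      using ae by (auto simp: g_def elim!: eventually_mono)
    ultimately show "integrable \<nu> (\<lambda>x. x ^ k)"
      using borel[OF g(1)] by (subst integrable_cong_AE[of _ _ g]) (auto elim: eventually_mono)
    have "(\<integral>x. x ^ k \<partial>\<nu>) = (\<integral>x. g x \<partial>\<nu>)"
      using borel[OF g(1)] ae_g by (intro integral_cong_AE) (auto elim: eventually_mono)
    moreover have "(\<lambda>n. \<integral>x. g x \<partial>approx_measure (r n)) \<longlonglongrightarrow> L ([:0, 1:] ^ k)"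
    proof -
      have "(\<integral>x. g x \<partial>approx_measure n) = (\<Sum>j\<le>n. weight n j * (real j / real n) ^ k)" for n
        unfolding integral_approx_measure[OF borel[OF g(1)]]
        by (rule sum.cong) (auto simp: g_def clamp_grid)
      then show ?thesis
        using LIMSEQ_subseq_LIMSEQ[OF sum_weight_power_tendsto[of k] r] by (simp add: o_def)
    qed
    ultimately show "(\<integral>x. x ^ k \<partial>\<nu>) = L ([:0, 1:] ^ k)"
      using limit[OF g] LIMSEQ_unique by metis
  qed
  have "integrable \<nu> (poly p)" and "(\<integral>x. poly p x \<partial>\<nu>) = L p" for p
  proof -
    have *: "poly p = (\<lambda>x. \<Sum>k\<le>degree p. coeff p k * x ^ k)"
      by (simp add: fun_eq_iff poly_altdef)
    show "integrable \<nu> (poly p)"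
      unfolding * using powers by auto
    have "(\<integral>x. poly p x \<partial>\<nu>) = (\<Sum>k\<le>degree p. coeff p k * L ([:0, 1:] ^ k))"
      unfolding * using powers by simp
    also have "\<dots> = L (\<Sum>k\<le>degree p. smult (coeff p k) ([:0, 1:] ^ k))"
      by (simp add: L_sum L_smult)
    also have "(\<Sum>k\<le>degree p. smult (coeff p k) ([:0, 1:] ^ k)) = p"
      using poly_as_sum_of_monoms[of p] by (simp add: monom_altdef)
    finally show "(\<integral>x. poly p x \<partial>\<nu>) = L p" .
  qed
  moreover have "AE x in \<nu>. 0 \<le> x \<and> x \<le> 1"
    using ae by (auto simp: clamp_def elim!: eventually_mono)
  ultimately show ?thesis using \<nu> by blast
qed

end

text \<open>
  The affine substitution that carries \<open>[-C, C]\<close> to \<open>[0, 1]\<close> reduces to the unit interval; pushing the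
  measure forward along its inverse undoes the substitution.
\<close>

lemma interval_representing_measure:
  fixes L :: "real poly \<Rightarrow> real"
  assumes L_add: "\<And>p q. L (p + q) = L p + L q"
    and L_smult: "\<And>c p. L (smult c p) = c * L p"
    and L_1: "L 1 = 1"
    and L_lower: "\<And>p. 0 \<le> L (p * p * [:C, 1:])"
    and L_upper: "\<And>p. 0 \<le> L (p * p * [:C, -1:])"
    and C: "0 < C"
  shows "\<exists>\<nu>. measure_with_moments (\<lambda>k. of_real (L ([:0, 1:] ^ k))) \<nu> \<and> (AE x in \<nu>. \<bar>x\<bar> \<le> C)"
proof -
  define s :: "real poly" where "s = [:1/2, 1/(2 * C):]"
  define t :: "real poly" where "t = [:-C, 2 * C:]"
  have ts: "t \<circ>\<^sub>p s = [:0, 1:]"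
    using C by (simp add: s_def t_def pcompose_pCons)
  interpret unit_interval_functional "\<lambda>p. L (p \<circ>\<^sub>p s)"
  proof
    fix p
    have "(p * p * [:0, 1:]) \<circ>\<^sub>p s = smult (1 / (2 * C)) ((p \<circ>\<^sub>p s) * (p \<circ>\<^sub>p s) * [:C, 1:])"
    proof -
      have "[:0, 1:] \<circ>\<^sub>p s = smult (1 / (2 * C)) [:C, 1:]"
        using C by (simp add: s_def pcompose_pCons)
      then show ?thesis by (simp only: pcompose_mult mult_smult_right)
    qed
    then show "0 \<le> L ((p * p * [:0, 1:]) \<circ>\<^sub>p s)"
      using L_lower C by (simp only: L_smult) simp
    have "(p * p * [:1, -1:]) \<circ>\<^sub>p s = smult (1 / (2 * C)) ((p \<circ>\<^sub>p s) * (p \<circ>\<^sub>p s) * [:C, -1:])"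
    proof -
      have "[:1, -1:] \<circ>\<^sub>p s = smult (1 / (2 * C)) [:C, -1:]"
        using C by (simp add: s_def pcompose_pCons)
      then show ?thesis by (simp only: pcompose_mult mult_smult_right)
    qed
    then show "0 \<le> L ((p * p * [:1, -1:]) \<circ>\<^sub>p s)"
      using L_upper C by (simp only: L_smult) simp
  qed (simp_all add: pcompose_add pcompose_smult L_add L_smult pcompose_1 L_1)
  obtain \<nu> where \<nu>: "real_distribution \<nu>" and supp: "AE x in \<nu>. 0 \<le> x \<and> x \<le> 1"
    and int: "\<And>p. integrable \<nu> (poly p)" and L: "\<And>p. (\<integral>x. poly p x \<partial>\<nu>) = L (p \<circ>\<^sub>p s)"
    using representing_measure by blast
  interpret \<nu>: real_distribution \<nu> by fact
  define \<mu> where "\<mu> = distr \<nu> borel (poly t)"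
  have t_meas: "poly t \<in> borel_measurable borel"
    by (intro borel_measurable_continuous_onI continuous_intros)
  have pow: "poly t x ^ k = poly (t ^ k) x" for x k by simp
  have "real_distribution \<mu>"
    unfolding \<mu>_def using t_meas by (intro \<nu>.real_distribution_distr) simp
  moreover have "integrable \<mu> (\<lambda>x. x ^ k)" for k
    unfolding \<mu>_def using t_meas int[of "t ^ k"]
    by (subst integrable_distr_eq) (simp_all only: pow measurable_lborel1 \<nu>.events_eq_borel cong: measurable_cong_sets, auto)
  moreover have "(\<integral>x. x ^ k \<partial>\<mu>) = L ([:0, 1:] ^ k)" for k
  proof -
    have "(\<integral>x. x ^ k \<partial>\<mu>) = (\<integral>x. poly (t ^ k) x \<partial>\<nu>)"
      unfolding \<mu>_def pow[symmetric]
      using t_meas by (intro integral_distr) (simp_all cong: measurable_cong_sets)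
    also have "\<dots> = L ((t \<circ>\<^sub>p s) ^ k)"
    proof -
      have "t ^ k \<circ>\<^sub>p s = (t \<circ>\<^sub>p s) ^ k"
        by (induction k) (simp_all add: pcompose_1 pcompose_mult)
      then show ?thesis by (simp only: L)
    qed
    also have "\<dots> = L ([:0, 1:] ^ k)"
      by (simp only: ts)
    finally show ?thesis .
  qed
  moreover have "AE x in \<mu>. \<bar>x\<bar> \<le> C"
  proof -
    have "\<bar>poly t x\<bar> \<le> C" if "0 \<le> x" "x \<le> 1" for x
    proof -
      have "C * x \<le> C" "0 \<le> C * x" using that C by (simp_all add: mult_left_le)
      then show ?thesis by (simp add: t_def abs_le_iff) (simp add: algebra_simps)
    qed
    then have "AE x in \<nu>. \<bar>poly t x\<bar> \<le> C"
      using supp by (auto elim: eventually_mono)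
    then show ?thesis
      unfolding \<mu>_def using t_meas by (subst AE_distr_iff) (simp_all cong: measurable_cong_sets)
  qed
  ultimately show ?thesis by (auto simp: measure_with_moments_def)
qed

section \<open>Spectral measures of locally finite symmetric kernels\<close>

definition point_mass :: "'x \<Rightarrow> 'x \<Rightarrow> real" where
  "point_mass x = (\<lambda>y. of_bool (y = x))"

text \<open>
  A symmetric matrix over an arbitrary index type whose rows are finite, so that it acts on all
  functions, and have absolute sum at most \<open>C\<close>, so that by the Schur test its quadratic form is
  bounded by \<open>C\<close>.
\<close>

locale bounded_symmetric_kernel =
  fixes K :: "'x \<Rightarrow> 'x \<Rightarrow> real" and C :: real
  assumes K_sym: "K x y = K y x"
    and K_finite: "finite {y. K x y \<noteq> 0}"
    and K_bound: "(\<Sum>y | K x y \<noteq> 0. \<bar>K x y\<bar>) \<le> C"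
    and C_pos: "0 < C"
begin

definition act :: "('x \<Rightarrow> real) \<Rightarrow> 'x \<Rightarrow> real" where
  "act \<xi> x = (\<Sum>y | K x y \<noteq> 0. K x y * \<xi> y)"

definition supp :: "('x \<Rightarrow> real) \<Rightarrow> 'x set" where
  "supp \<xi> = {x. \<xi> x \<noteq> 0}"

text \<open>
  Summing over the support of the first argument gives the inner product of a finitely supported
  function with an arbitrary one.
\<close>

definition pairing :: "('x \<Rightarrow> real) \<Rightarrow> ('x \<Rightarrow> real) \<Rightarrow> real" where
  "pairing \<xi> \<eta> = (\<Sum>x\<in>supp \<xi>. \<xi> x * \<eta> x)"

lemma act_eq_sum:
  assumes "finite B" "supp \<xi> \<subseteq> B"
  shows "act \<xi> x = (\<Sum>y\<in>B. K x y * \<xi> y)"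
proof -
  have "act \<xi> x = (\<Sum>y\<in>{y. K x y \<noteq> 0} \<union> B. K x y * \<xi> y)"
    unfolding act_def using K_finite[of x] assms by (intro sum.mono_neutral_left) auto
  also have "\<dots> = (\<Sum>y\<in>B. K x y * \<xi> y)"
    using K_finite[of x] assms by (intro sum.mono_neutral_right) (auto simp: supp_def)
  finally show ?thesis .
qed

lemma pairing_eq_sum:
  assumes "finite B" "supp \<xi> \<subseteq> B"
  shows "pairing \<xi> \<eta> = (\<Sum>x\<in>B. \<xi> x * \<eta> x)"
  unfolding pairing_def using assms by (intro sum.mono_neutral_left) (auto simp: supp_def)

lemma finite_supp_act:
  assumes "finite (supp \<xi>)"
  shows "finite (supp (act \<xi>))"
proof (rule finite_subset)
  show "supp (act \<xi>) \<subseteq> (\<Union>y\<in>supp \<xi>. {x. K y x \<noteq> 0})"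
  proof
    fix x assume "x \<in> supp (act \<xi>)"
    then have "(\<Sum>y | K x y \<noteq> 0. K x y * \<xi> y) \<noteq> 0" by (simp add: supp_def act_def)
    then obtain y where "K x y \<noteq> 0" "\<xi> y \<noteq> 0"
      by (auto elim: sum.not_neutral_contains_not_neutral)
    then show "x \<in> (\<Union>y\<in>supp \<xi>. {x. K y x \<noteq> 0})"
      using K_sym[of x y] by (auto simp: supp_def)
  qed
  show "finite (\<Union>y\<in>supp \<xi>. {x. K y x \<noteq> 0})" using assms K_finite by blast
qed

lemma pairing_act:
  assumes "finite (supp \<xi>)" "finite (supp \<eta>)"
  shows "pairing (act \<xi>) \<eta> = pairing \<xi> (act \<eta>)"
proof -
  define B where "B = supp \<xi> \<union> supp \<eta> \<union> supp (act \<xi>)"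
  have B: "finite B" "supp \<xi> \<subseteq> B" "supp \<eta> \<subseteq> B" "supp (act \<xi>) \<subseteq> B"
    using assms finite_supp_act by (auto simp: B_def)
  have "pairing (act \<xi>) \<eta> = (\<Sum>x\<in>B. \<Sum>y\<in>B. K x y * \<xi> y * \<eta> x)"
    using B by (simp add: pairing_eq_sum[of B] act_eq_sum[of B] sum_distrib_right)
  also have "\<dots> = (\<Sum>y\<in>B. \<Sum>x\<in>B. \<xi> y * (K y x * \<eta> x))"
    by (subst sum.swap) (simp add: K_sym mult_ac)
  also have "\<dots> = pairing \<xi> (act \<eta>)"
    using B by (simp add: pairing_eq_sum[of B] act_eq_sum[of B] sum_distrib_left)
  finally show ?thesis .
qed

text \<open>
  The Schur test: \<open>\<bar>\<xi> x \<xi> y\<bar> \<le> (\<xi> x\<^sup>2 + \<xi> y\<^sup>2) / 2\<close>, and by symmetry both halves contribute the same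
  weighted row sums.
\<close>

lemma abs_pairing_act_le:
  assumes fin: "finite (supp \<xi>)"
  shows "\<bar>pairing \<xi> (act \<xi>)\<bar> \<le> C * pairing \<xi> \<xi>"
proof -
  let ?S = "supp \<xi>"
  have row: "(\<Sum>y\<in>?S. \<bar>K x y\<bar>) \<le> C" for x
  proof -
    have "(\<Sum>y\<in>?S. \<bar>K x y\<bar>) = (\<Sum>y\<in>?S \<inter> {y. K x y \<noteq> 0}. \<bar>K x y\<bar>)"
      using fin by (intro sum.mono_neutral_right) auto
    also have "\<dots> \<le> (\<Sum>y | K x y \<noteq> 0. \<bar>K x y\<bar>)"
      using K_finite by (intro sum_mono2) auto
    finally show ?thesis using K_bound[of x] by simp
  qed
  have "\<bar>pairing \<xi> (act \<xi>)\<bar> = \<bar>\<Sum>x\<in>?S. \<Sum>y\<in>?S. K x y * (\<xi> x * \<xi> y)\<bar>"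
    using fin by (simp add: pairing_eq_sum[of ?S] act_eq_sum[of ?S] sum_distrib_left mult_ac)
  also have "\<dots> \<le> (\<Sum>x\<in>?S. \<Sum>y\<in>?S. \<bar>K x y\<bar> * (((\<xi> x)\<^sup>2 + (\<xi> y)\<^sup>2) / 2))"
  proof (intro order_trans[OF sum_abs] sum_mono)
    fix x y
    have "\<bar>\<xi> x * \<xi> y\<bar> \<le> ((\<xi> x)\<^sup>2 + (\<xi> y)\<^sup>2) / 2"
      using sum_squares_bound[of "\<bar>\<xi> x\<bar>" "\<bar>\<xi> y\<bar>"] by (simp add: abs_mult)
    then show "\<bar>K x y * (\<xi> x * \<xi> y)\<bar> \<le> \<bar>K x y\<bar> * (((\<xi> x)\<^sup>2 + (\<xi> y)\<^sup>2) / 2)"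
      unfolding abs_mult[of "K x y"] by (rule mult_left_mono) simp
  qed
  also have "\<dots> = ((\<Sum>x\<in>?S. \<Sum>y\<in>?S. \<bar>K x y\<bar> * (\<xi> x)\<^sup>2) + (\<Sum>x\<in>?S. \<Sum>y\<in>?S. \<bar>K x y\<bar> * (\<xi> y)\<^sup>2)) / 2"
    by (simp add: sum.distrib[symmetric] sum_divide_distrib algebra_simps add_divide_distrib)
  also have "(\<Sum>x\<in>?S. \<Sum>y\<in>?S. \<bar>K x y\<bar> * (\<xi> y)\<^sup>2) = (\<Sum>x\<in>?S. \<Sum>y\<in>?S. \<bar>K x y\<bar> * (\<xi> x)\<^sup>2)"
    by (subst sum.swap) (simp add: K_sym)
  also have "(\<dots> + \<dots>) / 2 = (\<Sum>x\<in>?S. (\<Sum>y\<in>?S. \<bar>K x y\<bar>) * (\<xi> x)\<^sup>2)"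
    by (simp add: sum_distrib_right)
  also have "\<dots> \<le> (\<Sum>x\<in>?S. C * (\<xi> x)\<^sup>2)"
    using row by (intro sum_mono mult_right_mono) auto
  also have "\<dots> = C * pairing \<xi> \<xi>"
    by (simp add: pairing_def sum_distrib_left power2_eq_square)
  finally show ?thesis .
qed

lemma supp_point: "supp (point_mass x) = {x}"
  by (auto simp: supp_def point_mass_def)

text \<open>
  The vector \<open>p(K) \<delta>\<^sub>x\<close>.
\<close>

definition cyclic_vector :: "'x \<Rightarrow> real poly \<Rightarrow> 'x \<Rightarrow> real" where
  "cyclic_vector x p = (\<lambda>y. \<Sum>i\<le>degree p. coeff p i * (act ^^ i) (point_mass x) y)"

lemma cyclic_vector_eq_sum:
  assumes "degree p \<le> n"
  shows "cyclic_vector x p y = (\<Sum>i\<le>n. coeff p i * (act ^^ i) (point_mass x) y)"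
  unfolding cyclic_vector_def using assms
  by (intro sum.mono_neutral_left) (auto simp: coeff_eq_0)

lemma cyclic_vector_add: "cyclic_vector x (p + q) y = cyclic_vector x p y + cyclic_vector x q y"
  using cyclic_vector_eq_sum[of p "max (degree p) (degree q)"]
    cyclic_vector_eq_sum[of q "max (degree p) (degree q)"]
    cyclic_vector_eq_sum[of "p + q" "max (degree p) (degree q)"]
  by (simp add: degree_add_le_max sum.distrib algebra_simps)

lemma cyclic_vector_smult: "cyclic_vector x (smult c p) y = c * cyclic_vector x p y"
  using cyclic_vector_eq_sum[of "smult c p" "degree p"]
  by (simp add: cyclic_vector_def sum_distrib_left mult_ac)

lemma cyclic_vector_monom: "cyclic_vector x ([:0, 1:] ^ k) = (act ^^ k) (point_mass x)"
proof
  fix y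
  have *: "coeff ([:0, 1:] ^ k) i = (of_bool (i = k) :: real)" for i
    by (simp flip: monom_altdef[of 1, simplified])
  have "cyclic_vector x ([:0, 1:] ^ k) y = (\<Sum>i\<le>k. coeff ([:0, 1:] ^ k) i * (act ^^ i) (point_mass x) y)"
    by (rule cyclic_vector_eq_sum) (simp add: degree_power_eq)
  also have "\<dots> = (\<Sum>i\<le>k. if i = k then (act ^^ i) (point_mass x) y else 0)"
    by (rule sum.cong) (auto simp: *)
  finally show "cyclic_vector x ([:0, 1:] ^ k) y = (act ^^ k) (point_mass x) y"
    by simp
qed

lemma finite_supp_iterate: "finite (supp ((act ^^ i) (point_mass x)))"
  by (induction i) (simp_all add: supp_point finite_supp_act)

lemma finite_supp_cyclic_vector: "finite (supp (cyclic_vector x p))"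
proof (rule finite_subset)
  show "supp (cyclic_vector x p) \<subseteq> (\<Union>i\<le>degree p. supp ((act ^^ i) (point_mass x)))"
  proof
    fix y assume "y \<in> supp (cyclic_vector x p)"
    then have "(\<Sum>i\<le>degree p. coeff p i * (act ^^ i) (point_mass x) y) \<noteq> 0"
      by (simp add: supp_def cyclic_vector_def)
    then obtain i where "i \<in> {..degree p}" "coeff p i * (act ^^ i) (point_mass x) y \<noteq> 0"
      by (rule sum.not_neutral_contains_not_neutral)
    then show "y \<in> (\<Union>i\<le>degree p. supp ((act ^^ i) (point_mass x)))"
      by (auto simp: supp_def)
  qed
qed (simp add: finite_supp_iterate)

lemma cyclic_vector_pCons_0: "cyclic_vector x (pCons 0 p) = act (cyclic_vector x p)"
proof
  fix y
  have "cyclic_vector x (pCons 0 p) y = (\<Sum>i\<le>Suc (degree p). coeff (pCons 0 p) i * (act ^^ i) (point_mass x) y)"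
    by (rule cyclic_vector_eq_sum) (rule degree_pCons_le)
  also have "\<dots> = (\<Sum>i\<le>degree p. coeff p i * act ((act ^^ i) (point_mass x)) y)"
    by (subst sum.atMost_Suc_shift) simp
  also have "\<dots> = act (cyclic_vector x p) y"
    unfolding act_def cyclic_vector_def
    by (simp add: sum_distrib_left sum.swap[of _ "{..degree p}"] mult_ac)
  finally show "cyclic_vector x (pCons 0 p) y = act (cyclic_vector x p) y" .
qed

text \<open>
  This is \<open>\<langle>p(K) \<delta>, q(K) \<delta>\<rangle> = \<langle>\<delta>, (p q)(K) \<delta>\<rangle>\<close>: one factor of the variable at a time is moved from
  \<open>p\<close> to \<open>q\<close> by symmetry of the kernel.
\<close>

lemma pairing_cyclic_vector:
  "pairing (cyclic_vector x p) (cyclic_vector x q) = cyclic_vector x (p * q) x"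
proof (induction p arbitrary: q)
  case 0
  show ?case by (simp add: cyclic_vector_def pairing_def supp_def)
next
  case (pCons c p)
  let ?v = "cyclic_vector x"
  define B where "B = supp (?v (pCons c p)) \<union> supp (act (?v p)) \<union> {x}"
  have B: "finite B" "supp (?v (pCons c p)) \<subseteq> B" "supp (act (?v p)) \<subseteq> B" "supp (point_mass x) \<subseteq> B"
    using finite_supp_cyclic_vector finite_supp_act by (auto simp: B_def supp_point)
  have split: "pCons c p = smult c 1 + pCons 0 p" by simp
  have one: "?v 1 = point_mass x" using cyclic_vector_monom[of x 0] by simp
  have v: "?v (pCons c p) y = c * point_mass x y + act (?v p) y" for y
    unfolding split cyclic_vector_add cyclic_vector_smult one cyclic_vector_pCons_0 ..
  have "pairing (?v (pCons c p)) (?v q) = c * pairing (point_mass x) (?v q) + pairing (act (?v p)) (?v q)"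
    using B by (simp add: pairing_eq_sum[of B] v sum.distrib sum_distrib_left algebra_simps)
  also have "pairing (point_mass x) (?v q) = ?v q x"
    by (simp add: pairing_def supp_point) (simp add: point_mass_def)
  also have "pairing (act (?v p)) (?v q) = pairing (?v p) (?v (pCons 0 q))"
    by (simp add: pairing_act finite_supp_cyclic_vector cyclic_vector_pCons_0)
  also have "\<dots> = ?v (p * pCons 0 q) x" by (rule pCons)
  also have "c * ?v q x + ?v (p * pCons 0 q) x = ?v (pCons c p * q) x"
    by (simp add: cyclic_vector_add[symmetric] cyclic_vector_smult[symmetric])
  finally show ?case .
qed

text \<open>
  The functional \<open>p \<mapsto> \<langle>\<delta>, p(K) \<delta>\<rangle>\<close> takes the value \<open>C \<langle>\<xi>, \<xi>\<rangle> \<plusminus> \<langle>\<xi>, K \<xi>\<rangle>\<close> with \<open>\<xi> = p(K) \<delta>\<close> on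
  \<open>p\<^sup>2 (C \<plusminus> x)\<close>, which is nonnegative by the Schur test.
\<close>

theorem spectral_measure_exists:
  "\<exists>\<nu>. measure_with_moments (\<lambda>k. of_real ((act ^^ k) (point_mass x) x)) \<nu> \<and> (AE t in \<nu>. \<bar>t\<bar> \<le> C)"
proof -
  have bounds: "0 \<le> cyclic_vector x (p * p * [:C, 1:]) x" "0 \<le> cyclic_vector x (p * p * [:C, -1:]) x" for p
  proof -
    let ?v = "cyclic_vector x p"
    have "cyclic_vector x (p * p * [:C, e:]) x = C * pairing ?v ?v + e * pairing ?v (act ?v)" for e
    proof -
      have "p * p * [:C, e:] = smult C (p * p) + smult e (p * pCons 0 p)"
        by (simp add: smult_add_right)
      then show ?thesis
        unfolding cyclic_vector_pCons_0[symmetric] pairing_cyclic_vector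
        by (simp only: cyclic_vector_add cyclic_vector_smult)
    qed
    from this[of 1] this[of "-1"]
    show "0 \<le> cyclic_vector x (p * p * [:C, 1:]) x" "0 \<le> cyclic_vector x (p * p * [:C, -1:]) x"
      using abs_pairing_act_le[OF finite_supp_cyclic_vector[of x p]] by linarith+
  qed
  have "cyclic_vector x 1 x = 1"
    using cyclic_vector_monom[of x 0] by (simp add: point_mass_def)
  from interval_representing_measure[of "\<lambda>p. cyclic_vector x p x" C, OF _ _ this bounds C_pos]
  show ?thesis
    unfolding cyclic_vector_monom by (simp add: cyclic_vector_add cyclic_vector_smult)
qed

end

section \<open>Square-summable functions and the reduced group algebra\<close>

lemma finite_support_in_ell2:
  assumes "finite {x. \<xi> x \<noteq> 0}" "{x. \<xi> x \<noteq> 0} \<subseteq> S"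
  shows "\<xi> \<in> ell2 S"
proof -
  have "(\<lambda>x. (cmod (\<xi> x))\<^sup>2) summable_on UNIV"
    using assms by (intro finite_nonzero_values_imp_summable_on) auto
  then show ?thesis using assms by (auto simp: ell2_def)
qed

lemma delta_in_ell2: "x \<in> S \<Longrightarrow> delta x \<in> ell2 S"
  by (rule finite_support_in_ell2) (auto simp: delta_def)

lemma ell2_inner_delta: "ell2_inner (delta x) \<xi> = \<xi> x"
proof -
  have "ell2_inner (delta x) \<xi> = (\<Sum>\<^sub>\<infinity>y\<in>{x}. cnj (delta x y) * \<xi> y)"
    unfolding ell2_inner_def by (rule infsum_cong_neutral) (auto simp: delta_def)
  then show ?thesis by (simp add: delta_def)
qed

lemma zero_in_ell2: "0 \<in> ell2 S"
  by (simp add: ell2_def)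

text \<open>
  Both parts follow from the pointwise bound \<open>\<bar>s + t\<bar>\<^sup>2 \<le> 2 \<bar>s\<bar>\<^sup>2 + 2 \<bar>t\<bar>\<^sup>2\<close>; the second one bounds sums of
  bounded operators.
\<close>

lemma add_in_ell2:
  assumes "\<xi> \<in> ell2 S" "\<eta> \<in> ell2 S"
  shows "\<xi> + \<eta> \<in> ell2 S"
    and "(ell2_norm (\<xi> + \<eta>))\<^sup>2 \<le> 2 * (ell2_norm \<xi>)\<^sup>2 + 2 * (ell2_norm \<eta>)\<^sup>2"
proof -
  have s: "(\<lambda>x. 2 * (cmod (\<xi> x))\<^sup>2 + 2 * (cmod (\<eta> x))\<^sup>2) summable_on UNIV"
    using assms by (intro summable_on_add summable_on_cmult_right) (auto simp: ell2_def)
  have le: "(cmod ((\<xi> + \<eta>) x))\<^sup>2 \<le> 2 * (cmod (\<xi> x))\<^sup>2 + 2 * (cmod (\<eta> x))\<^sup>2" for x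
  proof -
    have "(cmod ((\<xi> + \<eta>) x))\<^sup>2 \<le> (cmod (\<xi> x) + cmod (\<eta> x))\<^sup>2"
      by (intro power_mono) (auto intro: norm_triangle_ineq)
    also have "\<dots> \<le> 2 * (cmod (\<xi> x))\<^sup>2 + 2 * (cmod (\<eta> x))\<^sup>2"
      using sum_squares_bound[of "cmod (\<xi> x)" "cmod (\<eta> x)"] by (simp add: power2_sum)
    finally show ?thesis .
  qed
  have s': "(\<lambda>x. (cmod ((\<xi> + \<eta>) x))\<^sup>2) summable_on UNIV"
    using s le by (rule summable_on_comparison_test) auto
  then show "\<xi> + \<eta> \<in> ell2 S" using assms by (auto simp: ell2_def)
  have "(\<Sum>\<^sub>\<infinity>x. (cmod ((\<xi> + \<eta>) x))\<^sup>2) \<le> (\<Sum>\<^sub>\<infinity>x. 2 * (cmod (\<xi> x))\<^sup>2 + 2 * (cmod (\<eta> x))\<^sup>2)"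
    using s' s le by (rule infsum_mono)
  also have "\<dots> = 2 * (\<Sum>\<^sub>\<infinity>x. (cmod (\<xi> x))\<^sup>2) + 2 * (\<Sum>\<^sub>\<infinity>x. (cmod (\<eta> x))\<^sup>2)"
    using assms by (subst infsum_add)
      (auto simp: ell2_def infsum_cmult_right intro!: summable_on_cmult_right)
  finally show "(ell2_norm (\<xi> + \<eta>))\<^sup>2 \<le> 2 * (ell2_norm \<xi>)\<^sup>2 + 2 * (ell2_norm \<eta>)\<^sup>2"
    by (simp add: ell2_norm_def infsum_nonneg)
qed

lemma scale_in_ell2:
  assumes "\<xi> \<in> ell2 S"
  shows "(\<lambda>x. c * \<xi> x) \<in> ell2 S" and "ell2_norm (\<lambda>x. c * \<xi> x) = cmod c * ell2_norm \<xi>"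
  using assms
  by (auto simp: ell2_def ell2_norm_def norm_mult power_mult_distrib infsum_cmult_right real_sqrt_mult
      intro!: summable_on_cmult_right)

lemma ell2_norm_nonneg: "0 \<le> ell2_norm \<xi>"
  by (simp add: ell2_norm_def infsum_nonneg)

lemma ell2_norm_zero: "ell2_norm 0 = 0"
  by (simp add: ell2_norm_def)

lemma zero_in_bounded_ops: "0 \<in> bounded_ops S"
  by (auto simp: bounded_ops_def zero_in_ell2 ell2_norm_zero zero_fun_def[symmetric] intro!: exI[of _ 0])

lemma add_in_bounded_ops:
  assumes "T \<in> bounded_ops S" "U \<in> bounded_ops S"
  shows "T + U \<in> bounded_ops S"
proof -
  obtain C where C: "\<And>\<xi>. \<xi> \<in> ell2 S \<Longrightarrow> ell2_norm (T \<xi>) \<le> C * ell2_norm \<xi>"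
    using assms(1) unfolding bounded_ops_def by blast
  obtain D where D: "\<And>\<xi>. \<xi> \<in> ell2 S \<Longrightarrow> ell2_norm (U \<xi>) \<le> D * ell2_norm \<xi>"
    using assms(2) unfolding bounded_ops_def by blast
  have "ell2_norm ((T + U) \<xi>) \<le> sqrt (2 * C\<^sup>2 + 2 * D\<^sup>2) * ell2_norm \<xi>" if \<xi>: "\<xi> \<in> ell2 S" for \<xi>
  proof (rule power2_le_imp_le)
    have T: "T \<xi> \<in> ell2 S" "U \<xi> \<in> ell2 S" using assms \<xi> by (auto simp: bounded_ops_def)
    have "(ell2_norm ((T + U) \<xi>))\<^sup>2 \<le> 2 * (ell2_norm (T \<xi>))\<^sup>2 + 2 * (ell2_norm (U \<xi>))\<^sup>2"
      using add_in_ell2(2)[OF T] by simp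
    also have "\<dots> \<le> 2 * (C * ell2_norm \<xi>)\<^sup>2 + 2 * (D * ell2_norm \<xi>)\<^sup>2"
      using C[OF \<xi>] D[OF \<xi>] by (intro add_mono mult_left_mono power_mono) (auto simp: ell2_norm_nonneg)
    also have "\<dots> = (sqrt (2 * C\<^sup>2 + 2 * D\<^sup>2) * ell2_norm \<xi>)\<^sup>2"
      by (simp add: power_mult_distrib algebra_simps)
    finally show "(ell2_norm ((T + U) \<xi>))\<^sup>2 \<le> (sqrt (2 * C\<^sup>2 + 2 * D\<^sup>2) * ell2_norm \<xi>)\<^sup>2" .
  qed (simp add: ell2_norm_nonneg)
  moreover have "(T + U) \<xi> = 0" if "\<xi> \<notin> ell2 S" for \<xi>
    using assms that by (simp add: bounded_ops_def)
  moreover have "(T + U) \<xi> \<in> ell2 S" if "\<xi> \<in> ell2 S" for \<xi>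
    using assms that add_in_ell2(1)[of "T \<xi>" S "U \<xi>"] by (simp add: bounded_ops_def)
  moreover have "(T + U) (\<xi> + \<eta>) = (T + U) \<xi> + (T + U) \<eta>" if "\<xi> \<in> ell2 S" "\<eta> \<in> ell2 S" for \<xi> \<eta>
    using assms that by (simp add: bounded_ops_def algebra_simps)
  moreover have "(T + U) (\<lambda>x. c * \<xi> x) = (\<lambda>x. c * (T + U) \<xi> x)" if "\<xi> \<in> ell2 S" for c \<xi>
    using assms that by (simp add: bounded_ops_def fun_eq_iff algebra_simps)
  ultimately show ?thesis unfolding bounded_ops_def by blast
qed

lemma scale_in_bounded_ops:
  assumes "T \<in> bounded_ops S"
  shows "op_scale c T \<in> bounded_ops S"
proof -
  obtain C where C: "\<And>\<xi>. \<xi> \<in> ell2 S \<Longrightarrow> ell2_norm (T \<xi>) \<le> C * ell2_norm \<xi>"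
    using assms(1) unfolding bounded_ops_def by blast
  have "ell2_norm (op_scale c T \<xi>) \<le> (cmod c * C) * ell2_norm \<xi>" if \<xi>: "\<xi> \<in> ell2 S" for \<xi>
    using scale_in_ell2(2)[of "T \<xi>" S c] assms \<xi> mult_left_mono[OF C[OF \<xi>], of "cmod c"]
    by (simp add: op_scale_def bounded_ops_def mult.assoc)
  moreover have "op_scale c T \<xi> = 0" if "\<xi> \<notin> ell2 S" for \<xi>
    using assms that by (simp add: bounded_ops_def op_scale_def fun_eq_iff)
  moreover have "op_scale c T \<xi> \<in> ell2 S" if "\<xi> \<in> ell2 S" for \<xi>
    using assms that scale_in_ell2(1)[of "T \<xi>" S c] by (simp add: bounded_ops_def op_scale_def)
  moreover have "op_scale c T (\<xi> + \<eta>) = op_scale c T \<xi> + op_scale c T \<eta>"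
    if "\<xi> \<in> ell2 S" "\<eta> \<in> ell2 S" for \<xi> \<eta>
    using assms that by (simp add: bounded_ops_def op_scale_def fun_eq_iff algebra_simps)
  moreover have "op_scale c T (\<lambda>x. d * \<xi> x) = (\<lambda>x. d * op_scale c T \<xi> x)" if "\<xi> \<in> ell2 S" for d \<xi>
    using assms that by (simp add: bounded_ops_def op_scale_def fun_eq_iff algebra_simps)
  ultimately show ?thesis unfolding bounded_ops_def by blast
qed

lemma sum_in_bounded_ops:
  assumes "\<And>i. i \<in> I \<Longrightarrow> T i \<in> bounded_ops S"
  shows "(\<Sum>i\<in>I. T i) \<in> bounded_ops S"
  using assms
  by (induction I rule: infinite_finite_induct) (auto simp: zero_in_bounded_ops add_in_bounded_ops)

text \<open>
  Left translation permutes the group, so it preserves the norm.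
\<close>

lemma left_regular_in_bounded_ops:
  assumes "group \<Gamma>" and g: "g \<in> carrier \<Gamma>"
  shows "left_regular \<Gamma> g \<in> bounded_ops (carrier \<Gamma>)"
proof -
  interpret group \<Gamma> by fact
  let ?S = "carrier \<Gamma>" and ?L = "left_regular \<Gamma> g"
  have bij: "bij_betw (\<lambda>h. inv\<^bsub>\<Gamma>\<^esub> g \<otimes>\<^bsub>\<Gamma>\<^esub> h) ?S ?S"
    using g by (intro bij_betwI[of _ _ _ "\<lambda>h. g \<otimes>\<^bsub>\<Gamma>\<^esub> h"]) (auto simp: m_assoc[symmetric])
  have iso: "(\<lambda>x. (cmod (?L \<xi> x))\<^sup>2) summable_on UNIV"
      "(\<Sum>\<^sub>\<infinity>x. (cmod (?L \<xi> x))\<^sup>2) = (\<Sum>\<^sub>\<infinity>x. (cmod (\<xi> x))\<^sup>2)" if \<xi>: "\<xi> \<in> ell2 ?S" for \<xi>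
  proof -
    have "(\<lambda>x. (cmod (\<xi> x))\<^sup>2) summable_on ?S"
      using \<xi> by (auto simp: ell2_def intro: summable_on_subset_banach)
    then have "(\<lambda>x. (cmod (\<xi> (inv\<^bsub>\<Gamma>\<^esub> g \<otimes>\<^bsub>\<Gamma>\<^esub> x)))\<^sup>2) summable_on ?S"
      using summable_on_reindex_bij_betw[OF bij, of "\<lambda>x. (cmod (\<xi> x))\<^sup>2"] by simp
    moreover have "(\<lambda>x. (cmod (?L \<xi> x))\<^sup>2) summable_on UNIV \<longleftrightarrow>
        (\<lambda>x. (cmod (\<xi> (inv\<^bsub>\<Gamma>\<^esub> g \<otimes>\<^bsub>\<Gamma>\<^esub> x)))\<^sup>2) summable_on ?S"
      using \<xi> by (intro summable_on_cong_neutral) (auto simp: left_regular_def)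
    ultimately show "(\<lambda>x. (cmod (?L \<xi> x))\<^sup>2) summable_on UNIV" by simp
    have "(\<Sum>\<^sub>\<infinity>x. (cmod (?L \<xi> x))\<^sup>2) = (\<Sum>\<^sub>\<infinity>x\<in>?S. (cmod (\<xi> (inv\<^bsub>\<Gamma>\<^esub> g \<otimes>\<^bsub>\<Gamma>\<^esub> x)))\<^sup>2)"
      using \<xi> by (intro infsum_cong_neutral) (auto simp: left_regular_def)
    also have "\<dots> = (\<Sum>\<^sub>\<infinity>x\<in>?S. (cmod (\<xi> x))\<^sup>2)"
      using infsum_reindex_bij_betw[OF bij, of "\<lambda>x. (cmod (\<xi> x))\<^sup>2"] by simp
    also have "\<dots> = (\<Sum>\<^sub>\<infinity>x. (cmod (\<xi> x))\<^sup>2)"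
      using \<xi> by (intro infsum_cong_neutral) (auto simp: ell2_def)
    finally show "(\<Sum>\<^sub>\<infinity>x. (cmod (?L \<xi> x))\<^sup>2) = (\<Sum>\<^sub>\<infinity>x. (cmod (\<xi> x))\<^sup>2)" .
  qed
  have "?L \<xi> = 0" if "\<xi> \<notin> ell2 ?S" for \<xi>
    using that by (simp add: left_regular_def)
  moreover have "?L \<xi> \<in> ell2 ?S" if "\<xi> \<in> ell2 ?S" for \<xi>
    using iso(1)[OF that] that by (auto simp: ell2_def left_regular_def)
  moreover have "?L (\<xi> + \<eta>) = ?L \<xi> + ?L \<eta>" if "\<xi> \<in> ell2 ?S" "\<eta> \<in> ell2 ?S" for \<xi> \<eta>
    using that add_in_ell2(1)[OF that] by (auto simp: left_regular_def fun_eq_iff)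
  moreover have "?L (\<lambda>x. c * \<xi> x) = (\<lambda>x. c * ?L \<xi> x)" if "\<xi> \<in> ell2 ?S" for c \<xi>
    using that scale_in_ell2(1)[OF that] by (auto simp: left_regular_def fun_eq_iff)
  moreover have "ell2_norm (?L \<xi>) \<le> 1 * ell2_norm \<xi>" if "\<xi> \<in> ell2 ?S" for \<xi>
    using iso(2)[OF that] by (simp add: ell2_norm_def)
  ultimately show ?thesis unfolding bounded_ops_def by blast
qed

lemma op_id_eq_left_regular:
  assumes "group \<Gamma>"
  shows "op_id (carrier \<Gamma>) = left_regular \<Gamma> \<one>\<^bsub>\<Gamma>\<^esub>"
proof -
  interpret group \<Gamma> by fact
  show ?thesis by (auto simp: op_id_def left_regular_def fun_eq_iff ell2_def)
qed

lemma sum_fun_apply: "(\<Sum>i\<in>I. T i) \<xi> = (\<Sum>i\<in>I. T i \<xi>)" for T :: "'i \<Rightarrow> 'x \<Rightarrow> 'y::comm_monoid_add"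
  by (induction I rule: infinite_finite_induct) auto

lemma op_scale_sum_left: "op_scale (\<Sum>i\<in>I. c i) T = (\<Sum>i\<in>I. op_scale (c i) T)"
  by (simp add: fun_eq_iff op_scale_def sum_fun_apply sum_distrib_right)

text \<open>
  The index map \<open>\<gamma>\<close> may repeat group elements, whereas membership in the algebra asks for coefficients
  indexed by group elements; the coefficients are collected along the fibres of \<open>\<gamma>\<close>.
\<close>

lemma combination_in_reduced_group_algebra:
  assumes "group \<Gamma>" and I: "finite I" and \<gamma>: "\<gamma> ` I \<subseteq> carrier \<Gamma>"
  shows "(\<Sum>i\<in>I. op_scale (c i) (left_regular \<Gamma> (\<gamma> i))) \<in> reduced_group_algebra \<Gamma>"
proof -
  let ?T = "\<Sum>i\<in>I. op_scale (c i) (left_regular \<Gamma> (\<gamma> i))"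
  define d where "d g = (\<Sum>i\<in>{i \<in> I. \<gamma> i = g}. c i)" for g
  have "?T = (\<Sum>g\<in>\<gamma> ` I. \<Sum>i\<in>{i \<in> I. \<gamma> i = g}. op_scale (c i) (left_regular \<Gamma> (\<gamma> i)))"
    by (rule sum.image_gen[OF I])
  also have "\<dots> = (\<Sum>g\<in>\<gamma> ` I. op_scale (d g) (left_regular \<Gamma> g))"
    unfolding d_def op_scale_sum_left by (intro sum.cong) auto
  finally have T: "?T = (\<Sum>g\<in>\<gamma> ` I. op_scale (d g) (left_regular \<Gamma> g))" .
  have "?T \<in> bounded_ops (carrier \<Gamma>)"
    using assms by (intro sum_in_bounded_ops scale_in_bounded_ops left_regular_in_bounded_ops) auto
  moreover have "op_norm (carrier \<Gamma>) (?T - (\<Sum>g\<in>\<gamma> ` I. op_scale (d g) (left_regular \<Gamma> g))) = 0"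
  proof -
    have ne: "{\<xi> \<in> ell2 (carrier \<Gamma>). ell2_norm \<xi> \<le> 1} \<noteq> {}"
      using zero_in_ell2[of "carrier \<Gamma>"] by (auto simp: ell2_norm_zero intro!: exI[of _ 0])
    show ?thesis
      unfolding T op_norm_def using ne by (simp add: ell2_norm_zero)
  qed
  ultimately have "?T \<in> bounded_ops (carrier \<Gamma>) \<and> (\<forall>\<epsilon>>0. \<exists>F c. finite F \<and> F \<subseteq> carrier \<Gamma> \<and>
      op_norm (carrier \<Gamma>) (?T - (\<Sum>g\<in>F. op_scale (c g) (left_regular \<Gamma> g))) < \<epsilon>)"
    using I \<gamma> by (intro conjI allI impI exI[of _ "\<gamma> ` I"] exI[of _ d]) simp_all
  then show ?thesis
    unfolding reduced_group_algebra_def mem_Collect_eq .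
qed

lemma matrix_tensor_add: "matrix_tensor (B + C) T = matrix_tensor B T + matrix_tensor C T"
  by (simp add: matrix_tensor_def vec_eq_iff fun_eq_iff op_scale_def algebra_simps)

lemma matrix_tensor_unit:
  "matrix_tensor (c *\<^sub>R matrix_unit i j) T $ u $ v = op_scale (if u = i \<and> v = j then of_real c else 0) T"
  by (simp add: matrix_tensor_def matrix_unit_def of_real_def)

section \<open>The universal cover as a locally finite graph\<close>

context jacobi_graph
begin

definition tree_step :: "'e list \<Rightarrow> 'e \<Rightarrow> 'e list" where
  "tree_step w e = (if w \<noteq> [] \<and> e = rv (last w) then butlast w else w @ [e])"

lemma Nil_in_nonbacktracking_walks:
  "v0 \<in> verts G \<Longrightarrow> [] \<in> nonbacktracking_walks G rv v0"
  by (auto simp: nonbacktracking_walks_def awalk_Nil_iff)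

lemma nonbacktracking_walk_end:
  assumes "w \<in> nonbacktracking_walks G rv v0"
  shows "awalk v0 w (cover_proj G v0 w)"
proof -
  obtain v where v: "awalk v0 w v" using assms by (auto simp: nonbacktracking_walks_def)
  then have "v = cover_proj G v0 w"
    by (auto simp: cover_proj_def awalk_verts_conv awlast_of_awalk elim!: awalkE)
  then show ?thesis using v by simp
qed

text \<open>
  The recursive description of the tree on which all inductions over its vertices rest.
\<close>

lemma snoc_in_nonbacktracking_walks:
  "w @ [e] \<in> nonbacktracking_walks G rv v0 \<longleftrightarrow>
     w \<in> nonbacktracking_walks G rv v0 \<and> e \<in> arcs G \<and> tail G e = cover_proj G v0 w \<and>
     (w = [] \<or> e \<noteq> rv (last w))"
  (is "?L \<longleftrightarrow> ?R")
proof
  assume ?L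
  then obtain v where v: "awalk v0 (w @ [e]) v" and s: "successively (\<lambda>e f. f \<noteq> rv e) (w @ [e])"
    by (auto simp: nonbacktracking_walks_def)
  then obtain u where u: "awalk v0 w u" "awalk u [e] v" by auto
  with s have w: "w \<in> nonbacktracking_walks G rv v0"
    by (auto simp: nonbacktracking_walks_def successively_append_iff)
  have "u = cover_proj G v0 w"
    using nonbacktracking_walk_end[OF w] u(1) by (metis awalk_ends_eqD awalk_Nil_iff awlast_of_awalk awalkE)
  with u w s show ?R by (auto simp: awalk_simps successively_append_iff)
next
  assume ?R
  then have "awalk v0 w (cover_proj G v0 w)" "awalk (cover_proj G v0 w) [e] (head G e)"
    using nonbacktracking_walk_end[of w v0] arc_implies_awalk[of e] by auto
  then have "awalk v0 (w @ [e]) (head G e)" by (rule awalk_appendI)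
  moreover have "successively (\<lambda>e f. f \<noteq> rv e) (w @ [e])"
    using \<open>?R\<close> by (auto simp: nonbacktracking_walks_def successively_append_iff)
  ultimately show ?L by (auto simp: nonbacktracking_walks_def)
qed

end

locale jacobi_graph_cover = jacobi_graph G rv a
  for G :: "('v, 'e) pre_digraph" and rv :: "'e \<Rightarrow> 'e" and a :: "'e \<Rightarrow> real" +
  fixes b :: "'v \<Rightarrow> real" and v0 :: 'v
  assumes v0: "v0 \<in> verts G"
begin

abbreviation "tree_verts \<equiv> nonbacktracking_walks G rv v0"
abbreviation "end_vertex \<equiv> cover_proj G v0"
abbreviation "cover \<equiv> universal_cover G rv v0"

lemma end_vertex_in_verts: "w \<in> tree_verts \<Longrightarrow> end_vertex w \<in> verts G"
  using nonbacktracking_walk_end awalk_hd_in_verts[of v0] by blast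

lemma tree_vertex_induct [consumes 1, case_names Nil snoc]:
  assumes "w \<in> tree_verts" and "P []"
    and "\<And>w e. \<lbrakk>w \<in> tree_verts; P w; e \<in> out_arcs G (end_vertex w); w = [] \<or> e \<noteq> rv (last w)\<rbrakk> \<Longrightarrow> P (w @ [e])"
  shows "P w"
  using assms(1)
  by (induction w rule: rev_induct) (use assms(2,3) in \<open>auto simp: snoc_in_nonbacktracking_walks\<close>)

lemma last_arc:
  assumes "w \<in> tree_verts" "w \<noteq> []"
  shows "last w \<in> arcs G" "tail G (last w) = end_vertex (butlast w)" "butlast w \<in> tree_verts"
    "head G (last w) = end_vertex w"
  using assms snoc_in_nonbacktracking_walks[of "butlast w" "last w" v0] by (auto simp: cover_proj_def)

lemma tree_step:
  assumes "w \<in> tree_verts" "e \<in> out_arcs G (end_vertex w)"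
  shows "tree_step w e \<in> tree_verts" "end_vertex (tree_step w e) = head G e"
  using assms last_arc[OF assms(1)]
  by (auto simp: tree_step_def snoc_in_nonbacktracking_walks head_rv) (auto simp: cover_proj_def)

text \<open>
  Connectedness enters here: following a path of the graph by tree steps ends above its last vertex.
\<close>

lemma fibre_nonempty:
  assumes "r \<in> verts G"
  shows "\<exists>w\<in>tree_verts. end_vertex w = r"
proof -
  have "v0 \<rightarrow>\<^sup>*\<^bsub>G\<^esub> r" using connected assms v0 by auto
  then show ?thesis
  proof (induction rule: reachable_induct)
    case base
    show ?case using Nil_in_nonbacktracking_walks[OF v0] by (auto simp: cover_proj_def)
  next
    case (step x y)
    then obtain w e where "w \<in> tree_verts" "end_vertex w = x" "e \<in> arcs G" "tail G e = x" "head G e = y"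
      by (auto simp: arcs_ends_def arc_to_ends_def)
    then show ?case using tree_step[of w e] by auto
  qed
qed

lemma tree_step_inj:
  assumes "tree_step w e = tree_step w e'"
  shows "e = e'"
proof -
  have "butlast w \<noteq> w @ [x]" for x by (auto dest: arg_cong[of _ _ length])
  with assms show ?thesis by (auto simp: tree_step_def eq_commute[of "w @ _"] split: if_splits)
qed

lemma tree_step_neq: "tree_step w e \<noteq> w"
proof -
  have "w \<noteq> [] \<Longrightarrow> butlast w \<noteq> w" by (cases w rule: rev_cases) auto
  then show ?thesis by (auto simp: tree_step_def)
qed

text \<open>
  The covering property: the edges of the tree at \<open>w\<close> correspond to the edges of the graph at the end
  vertex of \<open>w\<close>, the one edge that leads back to the parent of \<open>w\<close> being the reversal of its last edge.
\<close>

lemma tree_out_arcs: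
  assumes w: "w \<in> tree_verts"
  shows "out_arcs cover w = (\<lambda>e. (w, tree_step w e)) ` out_arcs G (end_vertex w)"
proof (intro equalityI subsetI)
  fix x assume "x \<in> out_arcs cover w"
  then obtain w' where x: "x = (w, w')" and w': "w' \<in> tree_verts"
    and adj: "\<exists>e. w' = w @ [e] \<or> w = w' @ [e]"
    by (auto simp: universal_cover_def)
  from adj obtain e where "w' = w @ [e] \<or> w = w' @ [e]" ..
  then have "\<exists>e\<in>out_arcs G (end_vertex w). w' = tree_step w e"
  proof
    assume "w' = w @ [e]"
    then show ?thesis
      using w' by (intro bexI[of _ e]) (auto simp: snoc_in_nonbacktracking_walks tree_step_def)
  next
    assume "w = w' @ [e]"
    then show ?thesis
      using w by (intro bexI[of _ "rv e"])
        (auto simp: snoc_in_nonbacktracking_walks tree_step_def rv_arcs tail_rv cover_proj_def)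
  qed
  then show "x \<in> (\<lambda>e. (w, tree_step w e)) ` out_arcs G (end_vertex w)" using x by auto
next
  fix x assume "x \<in> (\<lambda>e. (w, tree_step w e)) ` out_arcs G (end_vertex w)"
  then obtain e where e: "e \<in> out_arcs G (end_vertex w)" and x: "x = (w, tree_step w e)" by auto
  have "\<exists>e'. tree_step w e = w @ [e'] \<or> w = tree_step w e @ [e']"
    by (auto simp: tree_step_def intro: exI[of _ "last w"])
  then show "x \<in> out_arcs cover w"
    using w tree_step(1)[OF w e] by (auto simp: universal_cover_def x)
qed

lemma cover_weight_tree_step:
  assumes "w \<in> tree_verts"
  shows "cover_weight a (w, tree_step w e) = a e"
proof (cases "w \<noteq> [] \<and> e = rv (last w)")
  case True
  then have "length (butlast w) < length w" by (cases w) auto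
  then show ?thesis
    using True weight_rv[of "last w"] last_arc(1)[OF assms]
    by (auto simp: tree_step_def cover_weight_def)
qed (auto simp: tree_step_def cover_weight_def)

text \<open>
  The matrix of the Jacobi operator of the tree.
\<close>

definition tree_kernel :: "'e list \<Rightarrow> 'e list \<Rightarrow> real" where
  "tree_kernel w w' =
     (if w \<in> tree_verts \<and> w = w' then b (end_vertex w)
      else if (w, w') \<in> arcs cover then cover_weight a (w, w') else 0)"

lemma tree_kernel_sym: "tree_kernel w w' = tree_kernel w' w"
proof -
  have "(w, w') \<in> arcs cover \<longleftrightarrow> (w', w) \<in> arcs cover" by (auto simp: universal_cover_def)
  moreover have "cover_weight a (w, w') = cover_weight a (w', w)" if "(w, w') \<in> arcs cover"
  proof -
    have "length w \<noteq> length w'" using that by (auto simp: universal_cover_def)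
    then show ?thesis by (auto simp: cover_weight_def)
  qed
  ultimately show ?thesis by (auto simp: tree_kernel_def)
qed

lemma tree_kernel_outside: "w \<notin> tree_verts \<Longrightarrow> tree_kernel w w' = 0"
  by (auto simp: tree_kernel_def universal_cover_def)

lemma tree_kernel_self: "w \<in> tree_verts \<Longrightarrow> tree_kernel w w = b (end_vertex w)"
  by (simp add: tree_kernel_def)

lemma tree_kernel_step:
  assumes "w \<in> tree_verts" "e \<in> out_arcs G (end_vertex w)"
  shows "tree_kernel w (tree_step w e) = a e"
proof -
  have "(w, tree_step w e) \<in> out_arcs cover w"
    using tree_out_arcs[OF assms(1)] assms(2) by simp
  then show ?thesis
    using assms cover_weight_tree_step tree_step_neq[of w e] by (simp add: tree_kernel_def)
qed

lemma tree_kernel_support: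
  assumes "tree_kernel w w' \<noteq> 0"
  shows "w' \<in> insert w (tree_step w ` out_arcs G (end_vertex w))"
proof -
  have w: "w \<in> tree_verts" using assms tree_kernel_outside by blast
  have "w' = w \<or> (w, w') \<in> out_arcs cover w"
    using assms by (auto simp: tree_kernel_def universal_cover_def split: if_splits)
  then show ?thesis using tree_out_arcs[OF w] by auto
qed

text \<open>
  A row sum of the kernel becomes a sum over the edges of the finite graph, once for the action and
  once for the bound on absolute row sums.
\<close>

lemma sum_tree_kernel_support:
  fixes F :: "'e list \<Rightarrow> real"
  assumes w: "w \<in> tree_verts" and F: "\<And>w'. tree_kernel w w' = 0 \<Longrightarrow> F w' = 0"
  shows "(\<Sum>w' | tree_kernel w w' \<noteq> 0. F w') = F w + (\<Sum>e\<in>out_arcs G (end_vertex w). F (tree_step w e))"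
proof -
  let ?N = "tree_step w ` out_arcs G (end_vertex w)"
  have "(\<Sum>w' | tree_kernel w w' \<noteq> 0. F w') = (\<Sum>w'\<in>insert w ?N. F w')"
    using tree_kernel_support F by (intro sum.mono_neutral_left) auto
  also have "\<dots> = F w + (\<Sum>w'\<in>?N. F w')"
  proof (rule sum.insert)
    show "w \<notin> ?N" using tree_step_neq by (metis imageE)
  qed auto
  also have "(\<Sum>w'\<in>?N. F w') = (\<Sum>e\<in>out_arcs G (end_vertex w). F (tree_step w e))"
    using tree_step_inj by (subst sum.reindex) (auto simp: inj_on_def)
  finally show ?thesis .
qed

text \<open>
  A bound for the absolute row sums that does not depend on the base vertex; the summand \<open>1\<close> makes it
  positive even when all coefficients vanish.
\<close>

definition weight_bound :: real where
  "weight_bound = 1 + (\<Sum>v\<in>verts G. \<bar>b v\<bar>) + (\<Sum>e\<in>arcs G. \<bar>a e\<bar>)"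

sublocale kernel: bounded_symmetric_kernel tree_kernel weight_bound
proof
  fix w w' :: "'e list"
  show "tree_kernel w w' = tree_kernel w' w" by (rule tree_kernel_sym)
  show "finite {w'. tree_kernel w w' \<noteq> 0}"
    by (rule finite_subset[of _ "insert w (tree_step w ` out_arcs G (end_vertex w))"])
      (use tree_kernel_support in auto)
  have nonneg: "0 \<le> (\<Sum>v\<in>verts G. \<bar>b v\<bar>)" "0 \<le> (\<Sum>e\<in>arcs G. \<bar>a e\<bar>)"
    by (auto intro: sum_nonneg)
  then show "0 < weight_bound" unfolding weight_bound_def by linarith
  show "(\<Sum>w' | tree_kernel w w' \<noteq> 0. \<bar>tree_kernel w w'\<bar>) \<le> weight_bound"
  proof (cases "w \<in> tree_verts")
    case True
    have "(\<Sum>w' | tree_kernel w w' \<noteq> 0. \<bar>tree_kernel w w'\<bar>) =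
        \<bar>b (end_vertex w)\<bar> + (\<Sum>e\<in>out_arcs G (end_vertex w). \<bar>a e\<bar>)"
      using sum_tree_kernel_support[OF True, of "\<lambda>w'. \<bar>tree_kernel w w'\<bar>"]
      by (simp add: tree_kernel_self[OF True] tree_kernel_step[OF True])
    also have "\<bar>b (end_vertex w)\<bar> \<le> (\<Sum>v\<in>verts G. \<bar>b v\<bar>)"
      using end_vertex_in_verts[OF True] by (intro member_le_sum) auto
    also have "(\<Sum>e\<in>out_arcs G (end_vertex w). \<bar>a e\<bar>) \<le> (\<Sum>e\<in>arcs G. \<bar>a e\<bar>)"
      by (intro sum_mono2) auto
    finally show ?thesis by (simp add: weight_bound_def)
  next
    case False
    then show ?thesis using nonneg by (simp add: tree_kernel_outside weight_bound_def)
  qed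
qed

lemma tree_act:
  assumes "w \<in> tree_verts"
  shows "kernel.act \<xi> w = b (end_vertex w) * \<xi> w +
    (\<Sum>e\<in>out_arcs G (end_vertex w). a e * \<xi> (tree_step w e))"
proof -
  have "kernel.act \<xi> w = tree_kernel w w * \<xi> w +
      (\<Sum>e\<in>out_arcs G (end_vertex w). tree_kernel w (tree_step w e) * \<xi> (tree_step w e))"
    unfolding kernel.act_def
    by (rule sum_tree_kernel_support[OF assms, of "\<lambda>w'. tree_kernel w w' * \<xi> w'"]) simp
  also have "(\<Sum>e\<in>out_arcs G (end_vertex w). tree_kernel w (tree_step w e) * \<xi> (tree_step w e)) =
      (\<Sum>e\<in>out_arcs G (end_vertex w). a e * \<xi> (tree_step w e))"
    by (rule sum.cong[OF refl]) (simp only: tree_kernel_step[OF assms])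
  finally show ?thesis by (simp add: tree_kernel_self assms)
qed

lemma kernel_support_in_tree:
  assumes "w0 \<in> tree_verts"
  shows "kernel.supp ((kernel.act ^^ k) (point_mass w0)) \<subseteq> tree_verts"
proof (cases k)
  case 0
  then show ?thesis using assms by (simp add: kernel.supp_point)
next
  case (Suc k')
  have "kernel.act \<xi> w = 0" if "w \<notin> tree_verts" for \<xi> w
    using that by (simp add: kernel.act_def tree_kernel_outside)
  then show ?thesis using Suc by (auto simp: kernel.supp_def)
qed

text \<open>
  Iterates of a point mass stay finitely supported, hence square-summable, so the truncation of the
  operator outside the square-summable functions never takes effect.
\<close>

lemma cover_operator_power:
  assumes "w0 \<in> tree_verts"
  shows "(cover_operator G rv a b v0 ^^ k) (delta w0) =
    (\<lambda>w. of_real ((kernel.act ^^ k) (point_mass w0) w))"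
proof (induction k)
  case 0
  show ?case by (auto simp: delta_def point_mass_def)
next
  case (Suc k)
  let ?\<xi> = "(kernel.act ^^ k) (point_mass w0)"
  have verts_cover: "verts cover = tree_verts" by (simp add: universal_cover_def)
  have heads: "head cover = snd" by (simp add: universal_cover_def)
  have "(\<lambda>w. complex_of_real (?\<xi> w)) \<in> ell2 (verts cover)"
    unfolding verts_cover
    using kernel.finite_supp_iterate[of k w0] kernel_support_in_tree[OF assms, of k]
    by (intro finite_support_in_ell2) (simp_all add: kernel.supp_def)
  then have "cover_operator G rv a b v0 (\<lambda>w. of_real (?\<xi> w)) w = of_real (kernel.act ?\<xi> w)" for w
  proof (cases "w \<in> tree_verts")
    case True
    have "(\<Sum>f\<in>out_arcs cover w. of_real (cover_weight a f) * of_real (?\<xi> (head cover f))) =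
        (\<Sum>e\<in>out_arcs G (end_vertex w). complex_of_real (a e * ?\<xi> (tree_step w e)))"
      unfolding tree_out_arcs[OF True] heads
      by (subst sum.reindex) (auto simp: inj_on_def cover_weight_tree_step[OF True] dest: tree_step_inj)
    then show ?thesis
      using True \<open>_ \<in> ell2 (verts cover)\<close>
      by (simp add: cover_operator_def jacobi_operator_def verts_cover tree_act)
  next
    case False
    then show ?thesis
      using \<open>_ \<in> ell2 (verts cover)\<close>
      by (simp add: cover_operator_def jacobi_operator_def verts_cover kernel.act_def tree_kernel_outside)
  qed
  then show ?case using Suc.IH by auto
qed

end

section \<open>Developing the universal cover over the free product\<close>

text \<open>
  The axioms say that two directed edges carry the same letter exactly if they are equal or reversals
  of each other, so a letter names an undirected edge.
\<close>

locale labelled_jacobi_graph = jacobi_graph G rv a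
  for G :: "('v, 'e) pre_digraph" and rv :: "'e \<Rightarrow> 'e" and a :: "'e \<Rightarrow> real" +
  fixes b :: "'v \<Rightarrow> real" and lab :: "'e \<Rightarrow> nat"
  assumes lab_rv: "e \<in> arcs G \<Longrightarrow> lab (rv e) = lab e"
    and lab_eq: "e \<in> arcs G \<Longrightarrow> e' \<in> arcs G \<Longrightarrow> lab e = lab e' \<Longrightarrow> e' = e \<or> e' = rv e"
begin

text \<open>
  Two edges with the same letter and the same source coincide: an edge and its reversal start at
  different vertices unless they form a half-loop, which is its own reversal.
\<close>

lemma lab_inj_at_vertex:
  assumes "e \<in> arcs G" "e' \<in> arcs G" "lab e = lab e'" "tail G e = tail G e'"
  shows "e = e'"
  using lab_eq[OF assms(1-3)] tail_rv[OF assms(1)] half_loops[OF assms(1)] assms(4) by auto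

text \<open>
  The Jacobi operator of the graph on vertices paired with words, in which traversing \<open>e\<close> multiplies the
  word by \<open>lab e\<close> from the left.
\<close>

definition group_jacobi :: "('v \<times> nat list \<Rightarrow> real) \<Rightarrow> 'v \<times> nat list \<Rightarrow> real" where
  "group_jacobi \<xi> = (\<lambda>(u, h). b u * \<xi> (u, h) + (\<Sum>e\<in>out_arcs G u. a e * \<xi> (head G e, push (lab e) h)))"

lemma group_jacobi_apply:
  "group_jacobi \<xi> (u, h) = b u * \<xi> (u, h) + (\<Sum>e\<in>out_arcs G u. a e * \<xi> (head G e, push (lab e) h))"
  by (simp add: group_jacobi_def)

text \<open>
  Left multiplication by letters commutes with right translation by \<open>h0\<close>, so right translation
  is a symmetry of the graph that carries the point mass at \<open>(r, [])\<close> to the one at \<open>(r, h0)\<close>.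
\<close>

lemma group_jacobi_translate:
  assumes "distinct_adj h" "distinct_adj h0"
  shows "(group_jacobi ^^ k) (point_mass (r, h0)) (u, foldr push h h0) = (group_jacobi ^^ k) (point_mass (r, [])) (u, h)"
  using assms(1)
proof (induction k arbitrary: u h)
  case 0
  \<comment> \<open>Cancel \<open>h0\<close> on the right; its inverse is the reversed word.\<close>
  have "h = []" if "foldr push h h0 = h0"
  proof -
    have inv: "foldr push h0 (rev h0) = []" using foldr_push_rev[of "rev h0"] by simp
    have "h = foldr push h []" using foldr_push_Nil[OF 0] by simp
    also have "\<dots> = foldr push (foldr push h h0) (rev h0)"
      using foldr_push_assoc[of "rev h0" h h0] assms(2) by (simp add: inv)
    also have "\<dots> = []" by (simp add: that inv)
    finally show ?thesis .
  qed
  then show ?case by (auto simp: point_mass_def)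
next
  case (Suc k)
  have "(group_jacobi ^^ k) (point_mass (r, h0)) (v, push i (foldr push h h0)) =
      (group_jacobi ^^ k) (point_mass (r, [])) (v, push i h)" for v i
    using Suc.IH[of "push i h" v] Suc.prems assms(2)
    by (simp add: distinct_adj_push foldr_push_push)
  then show ?case using Suc by (simp add: group_jacobi_apply)
qed

end

locale labelled_cover = labelled_jacobi_graph G rv a b lab + jacobi_graph_cover G rv a b v0
  for G :: "('v, 'e) pre_digraph" and rv a b lab v0
begin

text \<open>
  The word is reversed because letters multiply from the left: the last edge of the walk contributes
  the leftmost letter.
\<close>

definition develop :: "'e list \<Rightarrow> 'v \<times> nat list" where
  "develop w = (end_vertex w, rev (map lab w))"

text \<open>
  Cancellation in the group happens exactly when the walk backtracks. If the new letter equals that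
  of the last edge \<open>x\<close>, then both the new edge and \<open>rv x\<close> start at the end of the walk and carry the
  same letter, so they are equal.
\<close>

lemma develop_tree_step:
  assumes w: "w \<in> tree_verts" and e: "e \<in> out_arcs G (end_vertex w)"
  shows "develop (tree_step w e) = (head G e, push (lab e) (snd (develop w)))"
proof (cases "w \<noteq> [] \<and> e = rv (last w)")
  case True
  then obtain w' x where w': "w = w' @ [x]" by (cases w rule: rev_cases) auto
  then show ?thesis
    using True tree_step(2)[OF w e] lab_rv[of x] last_arc(1)[OF w]
    by (simp add: develop_def tree_step_def)
next
  case False
  have "push (lab e) (rev (map lab w)) = lab e # rev (map lab w)"
  proof (cases w rule: rev_cases)
    case (snoc w' x)
    have x: "x \<in> arcs G" "head G x = end_vertex w" using last_arc[OF w] snoc by auto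
    have "lab e \<noteq> lab x"
    proof
      assume "lab e = lab x"
      then have "e = rv x"
        using lab_inj_at_vertex[of e "rv x"] e x by (simp add: rv_arcs lab_rv tail_rv)
      then show False using False snoc by simp
    qed
    then show ?thesis using snoc by simp
  qed simp
  then show ?thesis
    using False tree_step(2)[OF w e] by (auto simp: develop_def tree_step_def)
qed

lemma distinct_adj_develop:
  assumes "w \<in> tree_verts"
  shows "distinct_adj (snd (develop w))"
  using assms
proof (induction w rule: tree_vertex_induct)
  case (snoc w e)
  then have "develop (w @ [e]) = (head G e, push (lab e) (snd (develop w)))"
    using develop_tree_step[of w e] by (auto simp: tree_step_def)
  then show ?case using snoc by (simp add: distinct_adj_push)
qed (simp add: develop_def)

text \<open>
  The end vertex and the last letter determine the last edge, since its reversal is the unique edge with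
  that letter at the end vertex; the rest of the walk follows by induction.
\<close>

lemma develop_inj:
  assumes "w \<in> tree_verts" "w' \<in> tree_verts" "develop w = develop w'"
  shows "w = w'"
  using assms
proof (induction w arbitrary: w' rule: rev_induct)
  case Nil
  then show ?case by (simp add: develop_def)
next
  case (snoc e w)
  then obtain u e' where w': "w' = u @ [e']" and labs: "lab e = lab e'" "map lab w = map lab u"
    by (cases w' rule: rev_cases) (auto simp: develop_def)
  have e: "e \<in> arcs G" "w \<in> tree_verts" "tail G e = end_vertex w"
    and e': "e' \<in> arcs G" "u \<in> tree_verts" "tail G e' = end_vertex u"
    using snoc.prems w' by (auto simp: snoc_in_nonbacktracking_walks)
  have "head G e = head G e'" using snoc.prems w' by (simp add: develop_def cover_proj_def)
  then have "rv e = rv e'"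
    using lab_inj_at_vertex[of "rv e" "rv e'"] e e' labs by (simp add: rv_arcs lab_rv tail_rv)
  then have "e = e'" using rv_rv e e' by metis
  then have "develop w = develop u" using e e' labs by (simp add: develop_def)
  then show ?case using snoc.IH e e' w' \<open>e = e'\<close> by auto
qed

text \<open>
  Developing is a covering of graphs onto its image, so pulling back functions along it intertwines
  the two operators; injectivity matches the initial point masses.
\<close>

lemma tree_act_eq_group_jacobi:
  assumes "w0 \<in> tree_verts" "w \<in> tree_verts"
  shows "(kernel.act ^^ k) (point_mass w0) w = (group_jacobi ^^ k) (point_mass (develop w0)) (develop w)"
  using assms(2)
proof (induction k arbitrary: w)
  case 0
  then have "w = w0 \<longleftrightarrow> develop w = develop w0" using develop_inj[OF _ assms(1)] by blast
  then show ?case by (simp add: point_mass_def point_mass_def)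
next
  case (Suc k)
  let ?\<xi> = "(kernel.act ^^ k) (point_mass w0)" and ?\<eta> = "(group_jacobi ^^ k) (point_mass (develop w0))"
  have step: "?\<xi> (tree_step w e) = ?\<eta> (head G e, push (lab e) (snd (develop w)))"
    if "e \<in> out_arcs G (end_vertex w)" for e
    unfolding Suc.IH[OF tree_step(1)[OF Suc.prems that]] develop_tree_step[OF Suc.prems that] ..
  have "kernel.act ?\<xi> w = group_jacobi ?\<eta> (end_vertex w, snd (develop w))"
    unfolding tree_act[OF Suc.prems] group_jacobi_apply
    using step Suc.IH[OF Suc.prems] by (simp add: develop_def)
  then show ?case by (simp add: develop_def)
qed

text \<open>
  The image of the tree is closed under passing to neighbours, hence so is its complement, because
  edges can be reversed; the mass that starts inside therefore stays inside.
\<close>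

lemma group_jacobi_vanishes:
  assumes "x \<notin> develop ` tree_verts" "distinct_adj (snd x)" "w0 \<in> tree_verts"
  shows "(group_jacobi ^^ k) (point_mass (develop w0)) x = 0"
  using assms(1,2)
proof (induction k arbitrary: x)
  case 0
  then show ?case using assms(3) by (auto simp: point_mass_def)
next
  case (Suc k)
  obtain u h where x: "x = (u, h)" by fastforce
  have "(head G e, push (lab e) h) \<notin> develop ` tree_verts" if e: "e \<in> out_arcs G u" for e
  proof
    assume "(head G e, push (lab e) h) \<in> develop ` tree_verts"
    then obtain w where w: "w \<in> tree_verts" "develop w = (head G e, push (lab e) h)" by auto
    then have rve: "rv e \<in> out_arcs G (end_vertex w)"
      using e by (auto simp: develop_def rv_arcs tail_rv)
    \<comment> \<open>Going back along \<open>e\<close> from the neighbour returns to \<open>x\<close>.\<close>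
    have "develop (tree_step w (rv e)) = x"
      unfolding develop_tree_step[OF w(1) rve] w(2) x
      using e Suc.prems(2) by (simp add: head_rv lab_rv push_push x)
    then show False using Suc.prems(1) tree_step(1)[OF w(1) rve] by auto
  qed
  then have "(group_jacobi ^^ k) (point_mass (develop w0)) (head G e, push (lab e) h) = 0"
    if "e \<in> out_arcs G u" for e
    using that Suc.IH Suc.prems by (auto simp: x distinct_adj_push)
  then show ?case using Suc by (simp add: group_jacobi_apply x)
qed

end

context labelled_jacobi_graph
begin

text \<open>
  Take \<open>j\<close> as base vertex of the tree. Only the empty walk is developed to the empty word, and it ends
  at \<open>j\<close>.
\<close>

lemma group_jacobi_off_diagonal:
  assumes "i \<noteq> j" "j \<in> verts G"
  shows "(group_jacobi ^^ k) (point_mass (j, [])) (i, []) = 0"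
proof -
  interpret labelled_cover G rv a b lab j by unfold_locales (fact assms(2))
  have Nil: "[] \<in> tree_verts" "develop [] = (j, [])"
    using Nil_in_nonbacktracking_walks[OF assms(2)] by (auto simp: develop_def cover_proj_def)
  have "(i, []) \<notin> develop ` tree_verts"
    using assms(1) by (auto simp: develop_def cover_proj_def)
  from group_jacobi_vanishes[OF this _ Nil(1)] show ?thesis by (simp add: Nil(2))
qed

definition return_moment :: "'v \<Rightarrow> nat \<Rightarrow> real" where
  "return_moment r k = (group_jacobi ^^ k) (point_mass (r, [])) (r, [])"

end

context labelled_cover
begin

lemma cover_moment:
  assumes w: "w \<in> tree_verts"
  shows "ell2_inner (delta w) ((cover_operator G rv a b v0 ^^ k) (delta w)) = of_real (return_moment (end_vertex w) k)"
proof -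
  have "(kernel.act ^^ k) (point_mass w) w = return_moment (end_vertex w) k"
    using tree_act_eq_group_jacobi[OF w w, of k] distinct_adj_develop[OF w]
      group_jacobi_translate[of "[]" "snd (develop w)" k "end_vertex w" "end_vertex w"]
    by (simp add: develop_def return_moment_def)
  then show ?thesis
    by (simp add: ell2_inner_delta cover_operator_power[OF w])
qed

text \<open>
  Both facts are properties of the tree operator at any vertex above \<open>r\<close>, transported to the moments.
\<close>

lemma return_moment_bound:
  assumes "r \<in> verts G"
  shows "cmod (of_real (return_moment r k)) \<le> weight_bound ^ k"
    and "\<exists>\<nu>. measure_with_moments (\<lambda>k. of_real (return_moment r k)) \<nu>"
proof -
  obtain w where w: "w \<in> tree_verts" "end_vertex w = r" using fibre_nonempty[OF assms] by blast
  have "(\<lambda>k. complex_of_real (return_moment r k)) = (\<lambda>k. of_real ((kernel.act ^^ k) (point_mass w) w))"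
    using cover_moment[OF w(1)] by (simp add: w(2) ell2_inner_delta cover_operator_power[OF w(1)])
  then obtain \<nu> where \<nu>: "measure_with_moments (\<lambda>k. of_real (return_moment r k)) \<nu>"
    and "AE t in \<nu>. \<bar>t\<bar> \<le> weight_bound"
    using kernel.spectral_measure_exists[of w] by metis
  then show "cmod (of_real (return_moment r k)) \<le> weight_bound ^ k"
    by (rule moments_bounded_by_support)
  show "\<exists>\<nu>. measure_with_moments (\<lambda>k. of_real (return_moment r k)) \<nu>" using \<nu> by blast
qed

text \<open>
  Existence and uniqueness make the definite description well defined. A nonempty fibre over \<open>r\<close>
  prevents its condition from being vacuous, and the moments are the same on the whole fibre.
\<close>

theorem measure_with_return_moments_iff:
  assumes "r \<in> verts G"
  shows "measure_with_moments (\<lambda>k. of_real (return_moment r k)) \<nu> \<longleftrightarrow>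
    \<nu> = cover_spectral_measure G rv a b v0 r"
proof -
  let ?M = "measure_with_moments (\<lambda>k. of_real (return_moment r k))"
  obtain w where w: "w \<in> tree_verts" "end_vertex w = r" using fibre_nonempty[OF assms] by blast
  have "(\<forall>w\<in>verts cover. end_vertex w = r \<longrightarrow> measure_with_moments
      (\<lambda>k. ell2_inner (delta w) ((cover_operator G rv a b v0 ^^ k) (delta w))) \<mu>) \<longleftrightarrow> ?M \<mu>" for \<mu>
    using w cover_moment by (auto simp: universal_cover_def)
  then have "cover_spectral_measure G rv a b v0 r = (THE \<mu>. ?M \<mu>)"
    by (simp add: cover_spectral_measure_def)
  moreover have "\<exists>!\<mu>. ?M \<mu>"
    using return_moment_bound[OF assms] measure_with_moments_unique by blast
  ultimately show ?thesis by (metis the_equality theI')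
qed

end

section \<open>The operator matrix of a labelled graph\<close>

locale labelled_finite_graph = jacobi_graph G rv a
  for G :: "('n::finite, 'e) pre_digraph" and rv :: "'e \<Rightarrow> 'e" and a :: "'e \<Rightarrow> real" +
  fixes b :: "'n \<Rightarrow> real" and l m :: nat and f :: "nat \<Rightarrow> 'e"
  assumes verts_UNIV: "verts G = UNIV" and labelling: "edge_labelling G rv l m f"
begin

definition edge_pair :: "nat \<Rightarrow> 'e set" where
  "edge_pair i = {f i, rv (f i)}"

lemma labelling_parts:
  shows labels_le: "l \<le> m"
    and half_loop_labels: "f ` {1..l} = {e \<in> arcs G. tail G e = head G e}" "inj_on f {1..l}"
    and proper_edge_labels: "edge_pair ` {l + 1..m} = (\<lambda>e. {e, rv e}) ` {e \<in> arcs G. tail G e \<noteq> head G e}"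
      "inj_on edge_pair {l + 1..m}"
  using labelling unfolding edge_labelling_def bij_betw_def edge_pair_def[abs_def] by blast+

lemma half_loop_label:
  assumes "i \<in> {1..l}"
  shows "f i \<in> arcs G" "tail G (f i) = head G (f i)" "rv (f i) = f i"
proof -
  have "f i \<in> {e \<in> arcs G. tail G e = head G e}"
    unfolding half_loop_labels(1)[symmetric] using assms by (rule imageI)
  then show "f i \<in> arcs G" "tail G (f i) = head G (f i)" "rv (f i) = f i"
    using half_loops by auto
qed

lemma proper_edge_label:
  assumes "i \<in> {l + 1..m}"
  shows "f i \<in> arcs G" "tail G (f i) \<noteq> head G (f i)"
proof -
  have "edge_pair i \<in> (\<lambda>e. {e, rv e}) ` {e \<in> arcs G. tail G e \<noteq> head G e}"
    unfolding proper_edge_labels(1)[symmetric] using assms by (rule imageI)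
  then obtain e where "e \<in> arcs G" "tail G e \<noteq> head G e" "f i \<in> {e, rv e}"
    by (auto simp: edge_pair_def)
  then show "f i \<in> arcs G" "tail G (f i) \<noteq> head G (f i)"
    by (auto simp: rv_arcs tail_rv head_rv)
qed

lemma label_arc: "i \<in> {1..m} \<Longrightarrow> f i \<in> arcs G"
  using half_loop_label(1)[of i] proper_edge_label(1)[of i] by (cases "i \<le> l") auto

lemma edge_pair_subset: "i \<in> {1..m} \<Longrightarrow> edge_pair i \<subseteq> arcs G"
  using label_arc by (auto simp: edge_pair_def rv_arcs)

lemma edge_pair_eq: "i \<in> {1..m} \<Longrightarrow> e \<in> edge_pair i \<Longrightarrow> edge_pair i = {e, rv e}"
  using label_arc by (auto simp: edge_pair_def rv_rv)

lemma arcs_eq_UN_edge_pair: "arcs G = (\<Union>i\<in>{1..m}. edge_pair i)"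
proof
  show "arcs G \<subseteq> (\<Union>i\<in>{1..m}. edge_pair i)"
  proof
    fix e assume e: "e \<in> arcs G"
    show "e \<in> (\<Union>i\<in>{1..m}. edge_pair i)"
    proof (cases "tail G e = head G e")
      case True
      then have "e \<in> f ` {1..l}" unfolding half_loop_labels(1) using e by simp
      then obtain i where "i \<in> {1..l}" "e = f i" by auto
      then show ?thesis using labels_le by (intro UN_I[of i]) (auto simp: edge_pair_def)
    next
      case False
      then have "{e, rv e} \<in> edge_pair ` {l + 1..m}"
        unfolding proper_edge_labels(1) using e by simp
      then obtain i where "i \<in> {l + 1..m}" "edge_pair i = {e, rv e}" by auto
      then show ?thesis by (intro UN_I[of i]) auto
    qed
  qed
qed (use edge_pair_subset in blast)

text \<open>
  A labelling treats half-loops and other edges separately, so besides injectivity on each range of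
  labels one has to see that no edge is of both kinds.
\<close>

lemma edge_pair_disjoint:
  assumes i: "i \<in> {1..m}" "j \<in> {1..m}" and e: "e \<in> edge_pair i" "e \<in> edge_pair j"
  shows "i = j"
proof -
  have loop: "tail G e = head G e \<longleftrightarrow> k \<le> l" if "k \<in> {1..m}" "e \<in> edge_pair k" for k
    using that half_loop_label[of k] proper_edge_label[of k]
    by (cases "k \<le> l") (auto simp: edge_pair_def tail_rv head_rv)
  then have same: "i \<le> l \<longleftrightarrow> j \<le> l" using i e by metis
  have eq: "edge_pair i = edge_pair j" using edge_pair_eq assms by metis
  show ?thesis
  proof (cases "i \<le> l")
    case True
    then have "i \<in> {1..l}" "j \<in> {1..l}" using same i by auto
    moreover from this have "f i = f j" using eq half_loop_label(3) by (auto simp: edge_pair_def)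
    ultimately show ?thesis using half_loop_labels(2) by (auto dest: inj_onD)
  next
    case False
    then have "i \<in> {l + 1..m}" "j \<in> {l + 1..m}" using same i by auto
    then show ?thesis using eq proper_edge_labels(2) by (auto dest: inj_onD)
  qed
qed

definition lab :: "'e \<Rightarrow> nat" where
  "lab e = (THE i. i \<in> {1..m} \<and> e \<in> edge_pair i)"

lemma lab_eqI: "i \<in> {1..m} \<Longrightarrow> e \<in> edge_pair i \<Longrightarrow> lab e = i"
  unfolding lab_def using edge_pair_disjoint by blast

lemma lab_arc:
  assumes "e \<in> arcs G"
  shows "lab e \<in> {1..m}" "e \<in> edge_pair (lab e)"
proof -
  obtain i where "i \<in> {1..m}" "e \<in> edge_pair i" using assms arcs_eq_UN_edge_pair by auto
  with lab_eqI show "lab e \<in> {1..m}" "e \<in> edge_pair (lab e)" by auto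
qed

sublocale labelled_jacobi_graph G rv a b lab
proof
  fix e assume e: "e \<in> arcs G"
  show "lab (rv e) = lab e"
    using lab_arc[OF e] edge_pair_eq[OF lab_arc[OF e]] by (intro lab_eqI) auto
  fix e' assume e': "e' \<in> arcs G" and "lab e = lab e'"
  then show "e' = e \<or> e' = rv e"
    using lab_arc[OF e'] edge_pair_eq[OF lab_arc[OF e]] by auto
qed

text \<open>
  A half-loop label accounts for one directed edge, any other label for two. This matches the two
  sums in the definition of the operator matrix.
\<close>

lemma sum_arcs_by_label:
  fixes g :: "'e \<Rightarrow> 'c::comm_monoid_add"
  shows "(\<Sum>e\<in>arcs G. g e) = (\<Sum>i=1..l. g (f i)) + (\<Sum>i=l+1..m. g (f i) + g (rv (f i)))"
proof -
  have "(\<Sum>e\<in>arcs G. g e) = (\<Sum>i\<in>{1..m}. \<Sum>e\<in>edge_pair i. g e)"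
    unfolding arcs_eq_UN_edge_pair
  proof (rule sum.UNION_disjoint)
    show "\<forall>i\<in>{1..m}. \<forall>j\<in>{1..m}. i \<noteq> j \<longrightarrow> edge_pair i \<inter> edge_pair j = {}"
      using edge_pair_disjoint by blast
  qed (simp_all add: edge_pair_def)
  also have "{1..m} = {1..l} \<union> {l + 1..m}"
    using labels_le by auto
  also have "(\<Sum>i\<in>{1..l} \<union> {l + 1..m}. \<Sum>e\<in>edge_pair i. g e) =
      (\<Sum>i=1..l. \<Sum>e\<in>edge_pair i. g e) + (\<Sum>i=l+1..m. \<Sum>e\<in>edge_pair i. g e)"
    by (intro sum.union_disjoint) auto
  also have "(\<Sum>i=1..l. \<Sum>e\<in>edge_pair i. g e) = (\<Sum>i=1..l. g (f i))"
    using half_loop_label(3) by (intro sum.cong) (auto simp: edge_pair_def)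
  also have "(\<Sum>i=l+1..m. \<Sum>e\<in>edge_pair i. g e) = (\<Sum>i=l+1..m. g (f i) + g (rv (f i)))"
  proof (rule sum.cong[OF refl])
    fix i assume i: "i \<in> {l + 1..m}"
    then have "f i \<noteq> rv (f i)" using proper_edge_label[OF i] tail_rv by metis
    then show "(\<Sum>e\<in>edge_pair i. g e) = g (f i) + g (rv (f i))" by (simp add: edge_pair_def)
  qed
  finally show ?thesis .
qed

abbreviation "\<Gamma> \<equiv> Z2_free_product m"
abbreviation "X \<equiv> graph_element G rv a b l m f"

lemma graph_element_entry:
  "X $ u $ v = op_scale (if u = v then of_real (b u) else 0) (op_id (carrier \<Gamma>)) +
     (\<Sum>e\<in>arcs G. op_scale (if u = tail G e \<and> v = head G e then of_real (a e) else 0) (left_regular \<Gamma> [lab e]))"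
proof -
  define t where "t e = matrix_tensor (a e *\<^sub>R matrix_unit (tail G e) (head G e)) (left_regular \<Gamma> [lab e])" for e
  have lab_f: "lab (f i) = i" "lab (rv (f i)) = i" if "i \<in> {1..m}" for i
    using that by (auto intro!: lab_eqI simp: edge_pair_def)
  have "(\<Sum>i=1..l. matrix_tensor (a (f i) *\<^sub>R matrix_unit (tail G (f i)) (head G (f i))) (left_regular \<Gamma> [i])) =
      (\<Sum>i=1..l. t (f i))"
    using lab_f labels_le by (intro sum.cong) (auto simp: t_def)
  moreover have "(\<Sum>i=l+1..m. matrix_tensor
        (a (f i) *\<^sub>R matrix_unit (tail G (f i)) (head G (f i)) +
         a (rv (f i)) *\<^sub>R matrix_unit (tail G (rv (f i))) (head G (rv (f i)))) (left_regular \<Gamma> [i])) =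
      (\<Sum>i=l+1..m. t (f i) + t (rv (f i)))"
    using lab_f by (intro sum.cong) (auto simp: t_def matrix_tensor_add)
  ultimately have "X = (\<Sum>i\<in>UNIV. matrix_tensor (b i *\<^sub>R matrix_unit i i) (op_id (carrier \<Gamma>))) + (\<Sum>e\<in>arcs G. t e)"
    unfolding graph_element_def sum_arcs_by_label by (simp only: add.assoc)
  then have "X $ u $ v = (\<Sum>i\<in>UNIV. op_scale (if u = i \<and> v = i then of_real (b i) else 0) (op_id (carrier \<Gamma>))) +
      (\<Sum>e\<in>arcs G. t e $ u $ v)"
    by (simp add: sum_component matrix_tensor_unit)
  also have "(\<Sum>i\<in>UNIV. op_scale (if u = i \<and> v = i then complex_of_real (b i) else 0) (op_id (carrier \<Gamma>))) =
      op_scale (if u = v then of_real (b u) else 0) (op_id (carrier \<Gamma>))"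
  proof -
    have "(\<Sum>i\<in>UNIV. if u = i \<and> v = i then complex_of_real (b i) else 0) = (if u = v then of_real (b u) else 0)"
      by (cases "u = v") (auto intro: sum.neutral)
    then show ?thesis by (simp only: op_scale_sum_left[symmetric])
  qed
  finally show ?thesis by (simp only: t_def matrix_tensor_unit)
qed

lemma generator_in_carrier: "e \<in> arcs G \<Longrightarrow> [lab e] \<in> carrier \<Gamma>"
  using Z2_free_product_generators(1) lab_arc(1) by blast

lemma graph_element_in_reduced_group_algebra: "X \<in> matrices_over (reduced_group_algebra \<Gamma>)"
proof -
  have "X $ u $ v \<in> reduced_group_algebra \<Gamma>" for u v
  proof -
    interpret group \<Gamma> by (rule group_Z2_free_product)
    \<comment> \<open>The index \<open>None\<close> stands for the potential, whose group element is the identity.\<close>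
    define c :: "'e option \<Rightarrow> complex" where
      "c x = (case x of None \<Rightarrow> if u = v then of_real (b u) else 0
        | Some e \<Rightarrow> if u = tail G e \<and> v = head G e then of_real (a e) else 0)" for x
    define \<gamma> where "\<gamma> x = (case x of None \<Rightarrow> \<one>\<^bsub>\<Gamma>\<^esub> | Some e \<Rightarrow> [lab e])" for x
    have "X $ u $ v = (\<Sum>x\<in>insert None (Some ` arcs G). op_scale (c x) (left_regular \<Gamma> (\<gamma> x)))"
      unfolding graph_element_entry op_id_eq_left_regular[OF group_Z2_free_product]
      by (simp add: c_def \<gamma>_def sum.reindex)
    also have "\<dots> \<in> reduced_group_algebra \<Gamma>"
      using generator_in_carrier
      by (intro combination_in_reduced_group_algebra group_Z2_free_product) (auto simp: \<gamma>_def)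
    finally show ?thesis .
  qed
  then show ?thesis by (simp add: matrices_over_def)
qed

lemma left_regular_generator:
  assumes "i \<in> {1..m}" "\<xi> \<in> ell2 (carrier \<Gamma>)" "h \<in> carrier \<Gamma>"
  shows "left_regular \<Gamma> [i] \<xi> h = \<xi> (push i h)"
proof -
  interpret group \<Gamma> by (rule group_Z2_free_product)
  note g = Z2_free_product_generators[OF assms(1)]
  have "inv\<^bsub>\<Gamma>\<^esub> [i] = [i]" using inv_equality[of "[i]" "[i]"] g by simp
  then show ?thesis using assms by (simp add: left_regular_def) (simp add: Z2_free_product_def)
qed

lemma push_in_carrier: "i \<in> {1..m} \<Longrightarrow> h \<in> carrier \<Gamma> \<Longrightarrow> push i h \<in> carrier \<Gamma>"
  using set_push[of i h] by (auto simp: Z2_free_product_def distinct_adj_push)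

lemma graph_element_entry_apply:
  assumes \<xi>: "\<xi> \<in> ell2 (carrier \<Gamma>)" and h: "h \<in> carrier \<Gamma>"
  shows "(X $ u $ v) \<xi> h = (if u = v then of_real (b u) * \<xi> h else 0) +
    (\<Sum>e\<in>out_arcs G u. if head G e = v then of_real (a e) * \<xi> (push (lab e) h) else 0)"
proof -
  have "(X $ u $ v) \<xi> h = (if u = v then of_real (b u) * \<xi> h else 0) +
      (\<Sum>e\<in>arcs G. (if u = tail G e \<and> v = head G e then of_real (a e) else 0) * left_regular \<Gamma> [lab e] \<xi> h)"
    unfolding graph_element_entry using \<xi> by (simp add: sum_fun_apply op_scale_def op_id_def)
  also have "(\<Sum>e\<in>arcs G. (if u = tail G e \<and> v = head G e then complex_of_real (a e) else 0) * left_regular \<Gamma> [lab e] \<xi> h) =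
      (\<Sum>e\<in>arcs G. if tail G e = u then if head G e = v then of_real (a e) * \<xi> (push (lab e) h) else 0 else 0)"
    using left_regular_generator[OF lab_arc(1) \<xi> h] by (intro sum.cong) auto
  also have "\<dots> = (\<Sum>e\<in>out_arcs G u. if head G e = v then of_real (a e) * \<xi> (push (lab e) h) else 0)"
    by (simp add: sum.inter_filter[symmetric] out_arcs_def)
  finally show ?thesis .
qed

text \<open>
  The columns of powers follow the recursion of \<open>group_jacobi\<close>. Membership in the square-summable
  functions has to be carried along, because the operators are zero elsewhere.
\<close>

lemma graph_element_power_column:
  shows "(op_matrix_power (carrier \<Gamma>) X k $ u $ j) (delta []) \<in> ell2 (carrier \<Gamma>)" (is ?A)
    and "h \<in> carrier \<Gamma> \<Longrightarrow> (op_matrix_power (carrier \<Gamma>) X k $ u $ j) (delta []) h =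
      of_real ((group_jacobi ^^ k) (point_mass (j, [])) (u, h))" (is "_ \<Longrightarrow> ?B")
proof (induction k arbitrary: u h)
  case 0
  have one: "[] \<in> carrier \<Gamma>" by (simp add: Z2_free_product_def)
  have col: "(op_matrix_power (carrier \<Gamma>) X 0 $ u $ j) (delta []) = (if u = j then delta [] else 0)" for u
    using delta_in_ell2[OF one]
    by (auto simp: op_matrix_power_def matrix_tensor_def op_id_def op_scale_def mat_def fun_eq_iff)
  {
    case 1
    show ?case by (simp add: col delta_in_ell2[OF one] zero_in_ell2)
  next
    case 2
    show ?case unfolding col by (simp add: delta_def point_mass_def)
  }
next
  case (Suc k)
  let ?\<xi> = "\<lambda>v. (op_matrix_power (carrier \<Gamma>) X k $ v $ j) (delta [])"
  have col: "(op_matrix_power (carrier \<Gamma>) X (Suc k) $ u $ j) (delta []) = (\<Sum>v\<in>UNIV. (X $ u $ v) (?\<xi> v))" for u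
    by (simp add: op_matrix_power_def op_matrix_mult_def sum_fun_apply)
  {
    case 1
    have sum: "(\<Sum>v\<in>V. \<eta> v) \<in> ell2 (carrier \<Gamma>)" if "\<And>v. \<eta> v \<in> ell2 (carrier \<Gamma>)"
      for V :: "'n set" and \<eta> :: "'n \<Rightarrow> nat list \<Rightarrow> complex"
      using that by (induction V rule: infinite_finite_induct) (auto simp: zero_in_ell2 add_in_ell2)
    have "X $ u $ v \<in> bounded_ops (carrier \<Gamma>)" for v
      using graph_element_in_reduced_group_algebra by (simp add: matrices_over_def reduced_group_algebra_def)
    then have "(X $ u $ v) (?\<xi> v) \<in> ell2 (carrier \<Gamma>)" for v
      using Suc.IH(1) by (simp add: bounded_ops_def)
    then show ?case unfolding col by (rule sum)
  next
    case 2
    then have h: "h \<in> carrier \<Gamma>" .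
    let ?F = "(group_jacobi ^^ k) (point_mass (j, []))"
    have "(\<Sum>v\<in>UNIV. (X $ u $ v) (?\<xi> v)) h = (\<Sum>v\<in>UNIV. (if u = v then of_real (b u * ?F (u, h)) else 0) +
        (\<Sum>e\<in>out_arcs G u. if head G e = v then complex_of_real (a e * ?F (head G e, push (lab e) h)) else 0))"
    proof -
      have "?\<xi> v (push (lab e) h) = of_real (?F (v, push (lab e) h))" if "e \<in> out_arcs G u" for e v
        using that Suc.IH(2) h push_in_carrier lab_arc(1) by simp
      then have "(X $ u $ v) (?\<xi> v) h = (if u = v then of_real (b u * ?F (u, h)) else 0) +
          (\<Sum>e\<in>out_arcs G u. if head G e = v then complex_of_real (a e * ?F (head G e, push (lab e) h)) else 0)" for v
        unfolding graph_element_entry_apply[OF Suc.IH(1) h]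
        by (intro arg_cong2[where f = "(+)"] sum.cong refl) (simp_all add: Suc.IH(2)[OF h])
      then show ?thesis by (simp only: sum_fun_apply)
    qed
    also have "\<dots> = of_real (b u * ?F (u, h)) +
        (\<Sum>e\<in>out_arcs G u. \<Sum>v\<in>UNIV. if head G e = v then complex_of_real (a e * ?F (head G e, push (lab e) h)) else 0)"
      unfolding sum.distrib by (subst (2) sum.swap) simp
    also have "\<dots> = of_real (group_jacobi ?F (u, h))"
      by (simp add: group_jacobi_apply)
    finally show ?case unfolding col by simp
  }
qed

lemma conditional_expectation_power:
  "conditional_expectation \<Gamma> (op_matrix_power (carrier \<Gamma>) X k) $ i $ j =
     of_real ((group_jacobi ^^ k) (point_mass (j, [])) (i, []))"
  using graph_element_power_column(2)[of "[]" k i j]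
  by (simp add: conditional_expectation_def canonical_trace_def ell2_inner_delta)
    (simp add: Z2_free_product_def)

end

theorem proposition5p13:
  fixes G :: "('n::finite, 'e) pre_digraph" and rv :: "'e \<Rightarrow> 'e"
    and a :: "'e \<Rightarrow> real" and b :: "'n \<Rightarrow> real"
    and v0 :: 'n and l m :: nat and f :: "nat \<Rightarrow> 'e"
  assumes "jacobi_graph G rv a" and "verts G = UNIV"
    and "edge_labelling G rv l m f"
  shows
    "let \<Gamma> = Z2_free_product m;
         X = graph_element G rv a b l m f;
         E = conditional_expectation \<Gamma> :: nat list ell2_op ^ 'n ^ 'n \<Rightarrow> complex ^ 'n ^ 'n
     in X \<in> matrices_over (reduced_group_algebra \<Gamma>) \<and>
        (\<forall>p i j. i \<noteq> j \<longrightarrow> E (op_matrix_power (carrier \<Gamma>) X p) $ i $ j = 0) \<and>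
        (\<forall>r \<nu>. is_spectral_distribution \<Gamma> (\<lambda>Y. E Y $ r $ r) X \<nu> \<longleftrightarrow>
           \<nu> = cover_spectral_measure G rv a b v0 r) \<and>
        (\<forall>\<nu>. is_spectral_distribution \<Gamma> (\<lambda>Y. trace (E Y) / of_nat CARD('n)) X \<nu> \<longleftrightarrow>
           \<nu> = density_of_states G rv a b v0)"
proof -
  interpret labelled_finite_graph G rv a b l m f
    using assms by (simp add: labelled_finite_graph_def labelled_finite_graph_axioms_def)
  interpret labelled_cover G rv a b lab v0
    by unfold_locales (simp add: verts_UNIV)
  let ?E = "conditional_expectation \<Gamma> :: nat list ell2_op ^ 'n ^ 'n \<Rightarrow> complex ^ 'n ^ 'n"
  let ?\<mu> = "cover_spectral_measure G rv a b v0"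
  let ?c = "\<lambda>r k. complex_of_real (return_moment r k)"
  have diag: "?E (op_matrix_power (carrier \<Gamma>) X k) $ r $ r = ?c r k" for k r
    by (simp add: conditional_expectation_power return_moment_def)
  have fibre: "measure_with_moments (?c r) \<nu> \<longleftrightarrow> \<nu> = ?\<mu> r" for r \<nu>
    by (rule measure_with_return_moments_iff) (simp add: verts_UNIV)
  let ?d = "\<lambda>k. (\<Sum>r\<in>UNIV. ?c r k) / of_nat CARD('n)"
  have tr: "trace (?E (op_matrix_power (carrier \<Gamma>) X k)) / of_nat CARD('n) = ?d k" for k
    by (simp only: trace_def diag)
  have dos: "measure_with_moments ?d (density_of_states G rv a b v0)"
    using measure_with_moments_uniform_mixture[of ?c ?\<mu>] fibre
    by (simp add: density_of_states_def verts_UNIV)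
  have bound: "cmod (?d k) \<le> weight_bound ^ k" for k
  proof -
    have "cmod (\<Sum>r\<in>UNIV. ?c r k) \<le> (\<Sum>r\<in>(UNIV :: 'n set). weight_bound ^ k)"
      using return_moment_bound(1) verts_UNIV by (intro sum_norm_le) auto
    then show ?thesis by (simp add: norm_divide divide_le_eq mult.commute)
  qed
  have "measure_with_moments ?d \<nu> \<longleftrightarrow> \<nu> = density_of_states G rv a b v0" for \<nu>
    using dos measure_with_moments_unique[OF _ dos bound] by blast
  moreover have "?E (op_matrix_power (carrier \<Gamma>) X p) $ i $ j = 0" if "i \<noteq> j" for p i j
    using group_jacobi_off_diagonal[OF that] by (simp add: conditional_expectation_power verts_UNIV)
  ultimately show ?thesis
    unfolding Let_def is_spectral_distribution_def diag tr
    using graph_element_in_reduced_group_algebra fibre by blast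
qed

end
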